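(* The pair $(g,\eta)$ gives rise to a flat pencil of contravariant metrics on $\mathbb{C}^n/B_n$, where $g^{ij}(u)=\sum_{k,l}\frac{1-\delta^{kl}}{p_kp_l}\frac{\partial u_i}{\partial p_k}\frac{\partial u_j}{\partial p_l}$ and $\eta^{ij}(u)=\frac{\partial g^{ij}}{\partial u_{n-1}}(u)$.
   Context: $n\ge2$. $B_n$ acts on $\mathbb{C}^n$ (coordinates $p_1,\dots,p_n$) by permutations and sign changes of coordinates. $u_k=\sum_{1\le i_1<\dots<i_k\le n}p_{i_1}^2\cdots p_{i_k}^2$ ($k=1,\dots,n$) are basic invariants used as coordinates on the orbit space; $g^{ij}(u)$ is a polynomial in $u_1,\dots,u_n$. A pair of contravariant metrics $(g_1,g_2)$ forms a flat pencil if $g_1+\lambda g_2$ is a flat (nondegenerate) metric for all $\lambda$ and the contravariant Christoffel symbols of $g_1+\lambda g_2$ are $\Gamma^{ij}_{1,k}+\lambda\Gamma^{ij}_{2,k}$ for all $\lambda$, where $\Gamma^{ij}_{a,k}$ are those of $g_a$. Contravariant Christoffel symbols are $\Gamma^{ij}_k=-g^{is}\Gamma^j_{sk}$. *)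

theory Defs
  imports "HOL-Analysis.Analysis"
begin

text \<open>Points of C^n are modelled as functions nat => complex; only the
coordinates 1..n are relevant.  A contravariant metric on C^n is a family
G i j :: (nat => complex) => complex, indices i j in 1..n.\<close>

definition pd :: "((nat \<Rightarrow> complex) \<Rightarrow> complex) \<Rightarrow> nat \<Rightarrow> (nat \<Rightarrow> complex) \<Rightarrow> complex" where
  "pd f k x = deriv (\<lambda>t. f (x(k := t))) (x k)"

text \<open>Basic invariants of B_n: u_k = elementary symmetric polynomial of degree k in p_1^2..p_n^2.\<close>
definition usym :: "nat \<Rightarrow> nat \<Rightarrow> (nat \<Rightarrow> complex) \<Rightarrow> complex" where
  "usym n k p = (\<Sum>S\<in>{S. S \<subseteq> {1..n} \<and> card S = k}. \<Prod>i\<in>S. (p i)^2)"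

text \<open>The metric g in the p-coordinates (valid for p with all coordinates nonzero).\<close>
definition gp :: "nat \<Rightarrow> nat \<Rightarrow> nat \<Rightarrow> (nat \<Rightarrow> complex) \<Rightarrow> complex" where
  "gp n i j p = (\<Sum>k=1..n. \<Sum>l=1..n.
      (if k = l then 0 else 1 / (p k * p l)) * pd (usym n i) k p * pd (usym n j) l p)"

definition poly_fun :: "nat \<Rightarrow> ((nat \<Rightarrow> complex) \<Rightarrow> complex) \<Rightarrow> bool" where
  "poly_fun n f \<longleftrightarrow> (\<exists>(A :: (nat \<Rightarrow> nat) set) (c :: (nat \<Rightarrow> nat) \<Rightarrow> complex). finite A \<and>
      (\<forall>u. f u = (\<Sum>\<alpha>\<in>A. c \<alpha> * (\<Prod>k=1..n. (u k) ^ (\<alpha> k)))))"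

type_synonym cmetric = "nat \<Rightarrow> nat \<Rightarrow> (nat \<Rightarrow> complex) \<Rightarrow> complex"

definition sym_metric :: "nat \<Rightarrow> cmetric \<Rightarrow> bool" where
  "sym_metric n G \<longleftrightarrow> (\<forall>i\<in>{1..n}. \<forall>j\<in>{1..n}. \<forall>u. G i j u = G j i u)"

definition nondeg :: "nat \<Rightarrow> cmetric \<Rightarrow> (nat \<Rightarrow> complex) \<Rightarrow> bool" where
  "nondeg n G u \<longleftrightarrow> (\<exists>h :: nat \<Rightarrow> nat \<Rightarrow> complex. \<forall>i\<in>{1..n}. \<forall>j\<in>{1..n}.
      (\<Sum>s=1..n. h i s * G s j u) = (if i = j then 1 else 0))"

text \<open>Covariant metric g_{ij} = inverse matrix of g^{ij} (meaningful where nondeg).\<close>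
definition cov :: "nat \<Rightarrow> cmetric \<Rightarrow> (nat \<Rightarrow> complex) \<Rightarrow> nat \<Rightarrow> nat \<Rightarrow> complex" where
  "cov n G u = (SOME h. \<forall>i\<in>{1..n}. \<forall>j\<in>{1..n}.
      (\<Sum>s=1..n. h i s * G s j u) = (if i = j then 1 else 0))"

definition chr :: "nat \<Rightarrow> cmetric \<Rightarrow> nat \<Rightarrow> nat \<Rightarrow> nat \<Rightarrow> (nat \<Rightarrow> complex) \<Rightarrow> complex" where
  "chr n G j s k u = (1/2) * (\<Sum>m=1..n. G j m u *
      (pd (\<lambda>v. cov n G v m k) s u + pd (\<lambda>v. cov n G v m s) k u - pd (\<lambda>v. cov n G v s k) m u))"

definition cchr :: "nat \<Rightarrow> cmetric \<Rightarrow> nat \<Rightarrow> nat \<Rightarrow> nat \<Rightarrow> (nat \<Rightarrow> complex) \<Rightarrow> complex" where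
  "cchr n G i j k u = - (\<Sum>s=1..n. G i s u * chr n G j s k u)"

definition riem :: "nat \<Rightarrow> cmetric \<Rightarrow> nat \<Rightarrow> nat \<Rightarrow> nat \<Rightarrow> nat \<Rightarrow> (nat \<Rightarrow> complex) \<Rightarrow> complex" where
  "riem n G a b c d u = pd (\<lambda>v. chr n G a d b v) c u - pd (\<lambda>v. chr n G a c b v) d u
      + (\<Sum>e=1..n. chr n G a c e u * chr n G e d b u - chr n G a d e u * chr n G e c b u)"

definition flat :: "nat \<Rightarrow> cmetric \<Rightarrow> bool" where
  "flat n G \<longleftrightarrow> (\<forall>u. nondeg n G u \<longrightarrow>
      (\<forall>a\<in>{1..n}. \<forall>b\<in>{1..n}. \<forall>c\<in>{1..n}. \<forall>d\<in>{1..n}. riem n G a b c d u = 0))"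

definition metric :: "nat \<Rightarrow> cmetric \<Rightarrow> bool" where
  "metric n G \<longleftrightarrow> sym_metric n G \<and> (\<exists>u. nondeg n G u)"

definition pencil :: "cmetric \<Rightarrow> cmetric \<Rightarrow> complex \<Rightarrow> cmetric" where
  "pencil g1 g2 c = (\<lambda>i j u. g1 i j u + c * g2 i j u)"

definition flat_pencil :: "nat \<Rightarrow> cmetric \<Rightarrow> cmetric \<Rightarrow> bool" where
  "flat_pencil n g1 g2 \<longleftrightarrow> metric n g1 \<and> metric n g2 \<and>
     (\<forall>c::complex.
        metric n (pencil g1 g2 c) \<and> flat n (pencil g1 g2 c) \<and>
        (\<forall>u. nondeg n g1 u \<and> nondeg n g2 u \<and> nondeg n (pencil g1 g2 c) u \<longrightarrow>
           (\<forall>i\<in>{1..n}. \<forall>j\<in>{1..n}. \<forall>k\<in>{1..n}.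
              cchr n (pencil g1 g2 c) i j k u = cchr n g1 i j k u + c * cchr n g2 i j k u)))"

end

theory Submission
  imports Defs "Jordan_Normal_Form.Determinant"
    "HOL-Computational_Algebra.Fundamental_Theorem_Algebra"
begin

text \<open>
  In the coordinates \<open>x\<^sub>k = p\<^sub>k\<^sup>2\<close> the metric \<open>g\<close> is the constant matrix \<open>4 (1 - \<delta>)\<close>, so it is flat, and
  its contravariant Christoffel symbols satisfy
  \<open>\<Sum>\<^sub>k \<Gamma>\<^sup>i\<^sup>j\<^sub>k \<partial>\<^sub>a u\<^sub>k = \<Sum>\<^sub>b\<^sub>c 4 (1 - \<delta>\<^sub>b\<^sub>c) \<partial>\<^sub>b u\<^sub>i \<partial>\<^sub>a \<partial>\<^sub>c u\<^sub>j\<close>. The recurrence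
  \<open>\<partial>\<^sub>b u\<^sub>k\<^sub>+\<^sub>1 = u\<^sub>k - x\<^sub>b \<partial>\<^sub>b u\<^sub>k\<close> gives closed formulas: there is a bilinear form \<open>B\<^sub>i\<^sub>j\<close> on sequences with
  \<open>g\<^sup>i\<^sup>j = 4 B\<^sub>i\<^sub>j(u, u)\<close> and \<open>\<Gamma>\<^sup>i\<^sup>j\<^sub>k = 4 B\<^sub>i\<^sub>j(u, \<partial>\<^sub>k u)\<close>. Hence \<open>\<Gamma>\<close> is affine in \<open>u\<close>, and \<open>g\<close> turns out to
  be affine in \<open>u\<^sub>n\<^sub>-\<^sub>1\<close>. Therefore \<open>g + \<lambda>\<eta>\<close> is the translate of \<open>g\<close> by \<open>\<lambda>\<close> in the direction \<open>u\<^sub>n\<^sub>-\<^sub>1\<close>, which is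
  flat, and its Christoffel symbols are affine in \<open>\<lambda>\<close>. By uniqueness of the Levi-Civita connection,
  the coefficient of \<open>\<lambda>\<close> is the Christoffel symbol of \<open>\<eta>\<close>. Every point of the orbit space comes from
  some \<open>x\<close> by the fundamental theorem of algebra, so all identities may be checked in \<open>x\<close>.
\<close>

section \<open>Inverse matrices depending on a parameter\<close>

declare One_nat_def [simp del]

definition left_inverse :: "nat \<Rightarrow> (nat \<Rightarrow> nat \<Rightarrow> complex) \<Rightarrow> (nat \<Rightarrow> nat \<Rightarrow> complex) \<Rightarrow> bool" where
  "left_inverse n h g \<longleftrightarrow> (\<forall>i\<in>{1..n}. \<forall>j\<in>{1..n}.
     (\<Sum>s=1..n. h i s * g s j) = (if i = j then 1 else 0))"

lemma left_inverseD:
  "left_inverse n h g \<Longrightarrow> i \<in> {1..n} \<Longrightarrow> j \<in> {1..n} \<Longrightarrow>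
    (\<Sum>s=1..n. h i s * g s j) = (if i = j then 1 else 0)"
  by (simp add: left_inverse_def)

definition fun_mat :: "nat \<Rightarrow> (nat \<Rightarrow> nat \<Rightarrow> complex) \<Rightarrow> complex mat" where
  "fun_mat n g = mat n n (\<lambda>(i, j). g (Suc i) (Suc j))"

lemma fun_mat_carrier [simp]: "fun_mat n g \<in> carrier_mat n n"
  by (simp add: fun_mat_def)

text \<open>Passes from functions indexed from 1 to matrices indexed from 0, which gives access to
  determinants, adjugates and two-sided inverses.\<close>

lemma left_inverse_iff_fun_mat: "left_inverse n h g \<longleftrightarrow> fun_mat n h * fun_mat n g = 1\<^sub>m n"
proof -
  have entry: "(fun_mat n h * fun_mat n g) $$ (i, j) = (\<Sum>s=1..n. h (Suc i) s * g s (Suc j))"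
    if "i < n" "j < n" for i j
    using that
    by (simp add: fun_mat_def scalar_prod_def)
       (rule sum.reindex_bij_witness[of _ "\<lambda>s. s - 1" Suc]; auto)
  show ?thesis
  proof
    assume "left_inverse n h g"
    then show "fun_mat n h * fun_mat n g = 1\<^sub>m n"
      by (intro eq_matI) (auto simp: entry left_inverse_def, auto simp: fun_mat_def)
  next
    assume *: "fun_mat n h * fun_mat n g = 1\<^sub>m n"
    show "left_inverse n h g"
      unfolding left_inverse_def
    proof (intro ballI)
      fix i j assume "i \<in> {1..n}" "j \<in> {1..n}"
      then show "(\<Sum>s=1..n. h i s * g s j) = (if i = j then 1 else 0)"
        using entry[of "i - 1" "j - 1"] unfolding * by (cases i; cases j) auto
    qed
  qed
qed

lemma left_inverse_commute: "left_inverse n h g \<Longrightarrow> left_inverse n g h"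
  unfolding left_inverse_iff_fun_mat
  by (rule mat_mult_left_right_inverse[OF fun_mat_carrier fun_mat_carrier])

lemma sum_delta_left:
  fixes f :: "nat \<Rightarrow> complex"
  shows "i \<in> {1..n} \<Longrightarrow> (\<Sum>j=1..n. (if i = j then 1 else 0) * f j) = f i"
  by (simp add: if_distrib[of "\<lambda>c. c * _"] cong: if_cong)

lemma sum_delta_right:
  fixes f :: "nat \<Rightarrow> complex"
  shows "i \<in> {1..n} \<Longrightarrow> (\<Sum>j=1..n. f j * (if j = i then 1 else 0)) = f i"
  by (simp add: if_distrib[of "\<lambda>c. _ * c"] cong: if_cong)

lemma left_inverse_cancel:
  assumes "left_inverse n h g" "i \<in> {1..n}"
  shows "(\<Sum>s=1..n. h i s * (\<Sum>j=1..n. g s j * f j)) = f i"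
proof -
  have "(\<Sum>s=1..n. h i s * (\<Sum>j=1..n. g s j * f j)) = (\<Sum>j=1..n. (\<Sum>s=1..n. h i s * g s j) * f j)"
    by (simp add: sum_distrib_left sum_distrib_right mult.assoc) (rule sum.swap)
  also have "\<dots> = (\<Sum>j=1..n. (if i = j then 1 else 0) * f j)"
    using assms by (intro sum.cong) (simp_all add: left_inverseD)
  finally show ?thesis using assms(2) by (simp only: sum_delta_left)
qed

lemma left_inverse_unique:
  assumes "left_inverse n h g" "left_inverse n h' g" "i \<in> {1..n}" "j \<in> {1..n}"
  shows "h i j = h' i j"
proof -
  have "h i j = (\<Sum>s=1..n. h i s * (if s = j then 1 else 0))"
    using assms(4) by (simp only: sum_delta_right)
  also have "\<dots> = (\<Sum>s=1..n. h i s * (\<Sum>k=1..n. g s k * h' k j))"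
    using left_inverse_commute[OF assms(2)] assms(4) by (intro sum.cong) (simp_all add: left_inverseD)
  also have "\<dots> = h' i j"
    by (rule left_inverse_cancel[OF assms(1,3)])
  finally show ?thesis .
qed

lemma left_inverse_symmetric:
  assumes "left_inverse n h g" "\<And>i j. i \<in> {1..n} \<Longrightarrow> j \<in> {1..n} \<Longrightarrow> g i j = g j i"
    "i \<in> {1..n}" "j \<in> {1..n}"
  shows "h i j = h j i"
proof -
  have "left_inverse n (\<lambda>i j. h j i) g"
    unfolding left_inverse_def
  proof (intro ballI)
    fix i j assume ij: "i \<in> {1..n}" "j \<in> {1..n}"
    have "(\<Sum>s=1..n. h s i * g s j) = (\<Sum>s=1..n. g j s * h s i)"
      using ij assms(2) by (intro sum.cong) (auto simp: mult.commute)
    also have "\<dots> = (if i = j then 1 else 0)"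
      using left_inverse_commute[OF assms(1)] ij by (auto simp: left_inverseD)
    finally show "(\<Sum>s=1..n. h s i * g s j) = (if i = j then 1 else 0)" .
  qed
  from left_inverse_unique[OF assms(1) this assms(3,4)] show ?thesis .
qed

text \<open>The choice made in \<open>cov\<close>, for a bare matrix, so that a metric along a curve
  becomes a matrix depending on one parameter. Only entries with indices in \<open>{1..n}\<close>
  are determined.\<close>

definition inverse_fun :: "nat \<Rightarrow> (nat \<Rightarrow> nat \<Rightarrow> complex) \<Rightarrow> nat \<Rightarrow> nat \<Rightarrow> complex" where
  "inverse_fun n g = (SOME h. left_inverse n h g)"

lemma left_inverse_inverse_fun: "left_inverse n h g \<Longrightarrow> left_inverse n (inverse_fun n g) g"
  unfolding inverse_fun_def by (rule someI[of "\<lambda>h. left_inverse n h g"])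

lemma field_differentiable_prod:
  fixes f :: "'i \<Rightarrow> complex \<Rightarrow> complex"
  assumes "\<And>i. i \<in> I \<Longrightarrow> f i field_differentiable at t0"
  shows "(\<lambda>t. \<Prod>i\<in>I. f i t) field_differentiable at t0"
  using assms by (induction I rule: infinite_finite_induct) (auto intro!: field_differentiable_mult)

lemma field_differentiable_det:
  fixes A :: "complex \<Rightarrow> complex mat"
  assumes "\<And>t. A t \<in> carrier_mat m m"
    "\<And>i j. i < m \<Longrightarrow> j < m \<Longrightarrow> (\<lambda>t. A t $$ (i, j)) field_differentiable at t0"
  shows "(\<lambda>t. Determinant.det (A t)) field_differentiable at t0"
proof -
  have "(\<lambda>t. \<Sum>p\<in>{p. p permutes {0..<m}}. signof p * (\<Prod>i = 0..<m. A t $$ (i, p i)))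
      field_differentiable at t0"
  proof (intro field_differentiable_sum field_differentiable_mult field_differentiable_const)
    fix p assume "p \<in> {p. p permutes {0..<m}}"
    then have "p i < m" if "i < m" for i
      using that permutes_in_image[of p "{0..<m}" i] by simp
    then show "(\<lambda>t. \<Prod>i = 0..<m. A t $$ (i, p i)) field_differentiable at t0"
      by (intro field_differentiable_prod assms) auto
  qed
  then show ?thesis by (simp add: det_def'[OF assms(1)])
qed

lemma left_inverse_imp_det: "left_inverse n h g \<Longrightarrow> Determinant.det (fun_mat n g) \<noteq> 0"
  using det_mult[OF fun_mat_carrier fun_mat_carrier, of n h g]
  by (auto simp: left_inverse_iff_fun_mat)

text \<open>Cramer's rule. Unlike the chosen inverse, this one is visibly rational in the entries of
  \<open>g\<close>.\<close>

lemma left_inverse_adjugate: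
  assumes "Determinant.det (fun_mat n g) \<noteq> 0"
  shows "left_inverse n (\<lambda>i j. adj_mat (fun_mat n g) $$ (i - 1, j - 1) / Determinant.det (fun_mat n g)) g"
proof -
  let ?d = "Determinant.det (fun_mat n g)" and ?a = "adj_mat (fun_mat n g)"
  have "fun_mat n (\<lambda>i j. ?a $$ (i - 1, j - 1) / ?d) = (1 / ?d) \<cdot>\<^sub>m ?a"
    using adj_mat(1)[OF fun_mat_carrier, of n g] by (intro eq_matI) (auto simp: fun_mat_def)
  then have "fun_mat n (\<lambda>i j. ?a $$ (i - 1, j - 1) / ?d) * fun_mat n g = (1 / ?d) \<cdot>\<^sub>m (?a * fun_mat n g)"
    using adj_mat(1)[OF fun_mat_carrier, of n g] by (simp add: mult_smult_assoc_mat[OF _ fun_mat_carrier])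
  also have "\<dots> = 1\<^sub>m n"
    using assms by (simp add: adj_mat(3)[OF fun_mat_carrier]) (intro eq_matI; auto)
  finally show ?thesis by (simp add: left_inverse_iff_fun_mat)
qed

lemma field_differentiable_adjugate:
  fixes M :: "complex \<Rightarrow> nat \<Rightarrow> nat \<Rightarrow> complex"
  assumes M: "\<And>i j. i \<in> {1..n} \<Longrightarrow> j \<in> {1..n} \<Longrightarrow> (\<lambda>t. M t i j) field_differentiable at t0"
    and ij: "i < n" "j < n"
  shows "(\<lambda>t. adj_mat (fun_mat n (M t)) $$ (i, j)) field_differentiable at t0"
proof -
  have car: "mat_delete (fun_mat n (M t)) j i \<in> carrier_mat (n - 1) (n - 1)" for t
    by (rule mat_delete_carrier) simp
  have "(\<lambda>t. Determinant.det (mat_delete (fun_mat n (M t)) j i)) field_differentiable at t0"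
  proof (rule field_differentiable_det[OF car])
    fix a b assume "a < n - 1" "b < n - 1"
    then show "(\<lambda>t. mat_delete (fun_mat n (M t)) j i $$ (a, b)) field_differentiable at t0"
      using ij by (auto simp: mat_delete_def fun_mat_def One_nat_def intro!: M)
  qed
  then show ?thesis
    using ij by (simp add: adj_mat_def cofactor_def fun_mat_def field_differentiable_mult)
qed

lemma has_field_derivative_cong_nhds:
  assumes "(f has_field_derivative D) (at x)" "eventually (\<lambda>y. f y = g y) (nhds x)"
  shows "(g has_field_derivative D) (at x)"
  using DERIV_cong_ev[OF refl assms(2) refl] assms(1) by simp

text \<open>Near \<open>t0\<close> the chosen inverse agrees with the adjugate divided by the
  determinant, hence is differentiable. The formula comes from differentiating its product with
  \<open>M t\<close>, which is the identity near \<open>t0\<close>.\<close>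

lemma has_field_derivative_inverse_fun:
  fixes M :: "complex \<Rightarrow> nat \<Rightarrow> nat \<Rightarrow> complex"
  assumes M: "\<And>i j. i \<in> {1..n} \<Longrightarrow> j \<in> {1..n} \<Longrightarrow> ((\<lambda>t. M t i j) has_field_derivative M' i j) (at t0)"
    and h: "left_inverse n h (M t0)"
  shows "eventually (\<lambda>t. left_inverse n (inverse_fun n (M t)) (M t)) (nhds t0)"
    and "i \<in> {1..n} \<Longrightarrow> j \<in> {1..n} \<Longrightarrow>
      ((\<lambda>t. inverse_fun n (M t) i j) has_field_derivative
        - (\<Sum>p=1..n. h i p * (\<Sum>q=1..n. M' p q * h q j))) (at t0)"
proof -
  have diff: "(\<lambda>t. M t i j) field_differentiable at t0" if "i \<in> {1..n}" "j \<in> {1..n}" for i j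
    using M[OF that] unfolding field_differentiable_def by blast
  define d where "d t = Determinant.det (fun_mat n (M t))" for t
  have d_diff: "d field_differentiable at t0"
    unfolding d_def by (rule field_differentiable_det[where m=n]) (auto simp: fun_mat_def One_nat_def intro!: diff)
  have d0: "d t0 \<noteq> 0"
    unfolding d_def by (rule left_inverse_imp_det[OF h])
  have "isCont d t0"
    using d_diff by (rule field_differentiable_imp_continuous_at)
  then have ev_d: "eventually (\<lambda>t. d t \<noteq> 0) (nhds t0)"
    using d0 by (simp add: isCont_def tendsto_imp_eventually_ne eventually_nhds_conv_at)
  define a where "a t i j = adj_mat (fun_mat n (M t)) $$ (i - 1, j - 1) / d t" for t and i j :: nat
  have a: "left_inverse n (a t) (M t)" if "d t \<noteq> 0" for t
    using left_inverse_adjugate[of n "M t"] that unfolding a_def d_def by simp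
  show ev: "eventually (\<lambda>t. left_inverse n (inverse_fun n (M t)) (M t)) (nhds t0)"
    using ev_d by eventually_elim (rule left_inverse_inverse_fun[OF a])
  have inv_diff: "(\<lambda>t. inverse_fun n (M t) i j) field_differentiable at t0"
    if ij: "i \<in> {1..n}" "j \<in> {1..n}" for i j
  proof -
    have "(\<lambda>t. a t i j) field_differentiable at t0"
      unfolding a_def using ij
      by (intro field_differentiable_divide field_differentiable_adjugate diff d_diff d0) auto
    then obtain D where "((\<lambda>t. a t i j) has_field_derivative D) (at t0)"
      unfolding field_differentiable_def by blast
    moreover have "eventually (\<lambda>t. a t i j = inverse_fun n (M t) i j) (nhds t0)"
      using ev ev_d
      by eventually_elim (use ij in \<open>auto intro: left_inverse_unique[OF a]\<close>)
    ultimately have "((\<lambda>t. inverse_fun n (M t) i j) has_field_derivative D) (at t0)"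
      by (rule has_field_derivative_cong_nhds)
    then show ?thesis unfolding field_differentiable_def by blast
  qed
  assume ij: "i \<in> {1..n}" "j \<in> {1..n}"
  define D where "D s = deriv (\<lambda>t. inverse_fun n (M t) i s) t0" for s
  have D: "((\<lambda>t. inverse_fun n (M t) i s) has_field_derivative D s) (at t0)" if "s \<in> {1..n}" for s
    using inv_diff[OF ij(1) that] unfolding D_def by (simp add: field_differentiable_derivI)
  have h_eq: "inverse_fun n (M t0) i s = h i s" if "s \<in> {1..n}" for s
    using left_inverse_unique[OF left_inverse_inverse_fun[OF h] h] ij that by blast
  have Dq: "(\<Sum>s=1..n. D s * M t0 s q) = - (\<Sum>s=1..n. h i s * M' s q)" if q: "q \<in> {1..n}" for q
  proof -
    have "((\<lambda>t. \<Sum>s=1..n. inverse_fun n (M t) i s * M t s q) has_field_derivative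
        (\<Sum>s=1..n. D s * M t0 s q + M' s q * inverse_fun n (M t0) i s)) (at t0)"
      using q by (intro DERIV_sum DERIV_mult D M) auto
    moreover have "((\<lambda>t. \<Sum>s=1..n. inverse_fun n (M t) i s * M t s q) has_field_derivative 0) (at t0)"
    proof -
      have "eventually (\<lambda>t. (\<Sum>s=1..n. inverse_fun n (M t) i s * M t s q) = (if i = q then 1 else 0)) (nhds t0)"
        using ev by eventually_elim (use ij q in \<open>simp add: left_inverseD\<close>)
      then show ?thesis
        by (subst DERIV_cong_ev[OF refl _ refl]) auto
    qed
    ultimately have "(\<Sum>s=1..n. D s * M t0 s q + M' s q * inverse_fun n (M t0) i s) = 0"
      by (rule DERIV_unique)
    moreover have "(\<Sum>s=1..n. D s * M t0 s q + M' s q * inverse_fun n (M t0) i s)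
        = (\<Sum>s=1..n. D s * M t0 s q) + (\<Sum>s=1..n. h i s * M' s q)"
      by (simp add: sum.distrib[symmetric] h_eq mult.commute)
    ultimately show ?thesis by (simp add: add_eq_0_iff2)
  qed
  \<comment> \<open>Solves \<open>Dq\<close> for \<open>D\<close> by multiplying with the right
    inverse \<open>h\<close> of \<open>M t0\<close>.\<close>
  have "D j = (\<Sum>s=1..n. D s * (if s = j then 1 else 0))"
    using ij by (simp only: sum_delta_right)
  also have "\<dots> = (\<Sum>s=1..n. D s * (\<Sum>q=1..n. M t0 s q * h q j))"
    using left_inverse_commute[OF h] ij by (intro sum.cong) (simp_all add: left_inverseD)
  also have "\<dots> = (\<Sum>q=1..n. (\<Sum>s=1..n. D s * M t0 s q) * h q j)"
    by (simp add: sum_distrib_left sum_distrib_right mult.assoc) (rule sum.swap)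
  also have "\<dots> = (\<Sum>q=1..n. - (\<Sum>s=1..n. h i s * M' s q) * h q j)"
    by (intro sum.cong) (simp_all add: Dq)
  also have "\<dots> = - (\<Sum>p=1..n. h i p * (\<Sum>q=1..n. M' p q * h q j))"
    by (simp add: sum_distrib_left sum_distrib_right mult.assoc sum_negf) (rule sum.swap)
  finally show "((\<lambda>t. inverse_fun n (M t) i j) has_field_derivative
        - (\<Sum>p=1..n. h i p * (\<Sum>q=1..n. M' p q * h q j))) (at t0)"
    using D[OF ij(2)] by simp
qed

section \<open>Gradients and the Levi-Civita connection\<close>

lemma cov_eq_inverse_fun: "cov n G u = inverse_fun n (\<lambda>i j. G i j u)"
  unfolding cov_def inverse_fun_def left_inverse_def ..

lemma nondeg_iff: "nondeg n G u \<longleftrightarrow> (\<exists>h. left_inverse n h (\<lambda>i j. G i j u))"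
  unfolding nondeg_def left_inverse_def ..

lemma left_inverse_cov: "nondeg n G u \<Longrightarrow> left_inverse n (cov n G u) (\<lambda>i j. G i j u)"
  unfolding nondeg_iff cov_eq_inverse_fun by (auto intro: left_inverse_inverse_fun)

text \<open>A chain rule along curves replaces total differentiability, because points are functions on all
  of \<open>nat\<close> and do not form a normed space.\<close>
definition has_gradient ::
    "nat \<Rightarrow> ((nat \<Rightarrow> complex) \<Rightarrow> complex) \<Rightarrow> (nat \<Rightarrow> complex) \<Rightarrow> (nat \<Rightarrow> complex) \<Rightarrow> bool" where
  "has_gradient n f f' u \<longleftrightarrow> (\<forall>w w' t. w t = u \<longrightarrow>
     (\<forall>k\<in>{1..n}. ((\<lambda>s. w s k) has_field_derivative w' k) (at t)) \<longrightarrow>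
     ((\<lambda>s. f (w s)) has_field_derivative (\<Sum>k=1..n. f' k * w' k)) (at t))"

lemma has_gradientD:
  assumes "has_gradient n f f' (w t)"
    "\<And>k. k \<in> {1..n} \<Longrightarrow> ((\<lambda>s. w s k) has_field_derivative w' k) (at t)"
  shows "((\<lambda>s. f (w s)) has_field_derivative (\<Sum>k=1..n. f' k * w' k)) (at t)"
  using assms unfolding has_gradient_def by blast

text \<open>The coordinate line \<open>u(k := s)\<close> is one of the admissible curves.\<close>

lemma pd_eq_gradient:
  assumes "has_gradient n f f' u" "k \<in> {1..n}"
  shows "pd f k u = f' k"
proof -
  have "((\<lambda>s. (u(k := s)) m) has_field_derivative (if m = k then 1 else 0)) (at (u k))" for m
    by (cases "m = k") auto
  then have "((\<lambda>s. f (u(k := s))) has_field_derivative (\<Sum>m=1..n. f' m * (if m = k then 1 else 0))) (at (u k))"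
    using assms(1) by (intro has_gradientD) simp_all
  then show ?thesis
    unfolding pd_def using assms(2) by (simp only: sum_delta_right DERIV_imp_deriv)
qed

lemma has_gradient_pd:
  assumes "has_gradient n f f' u"
  shows "has_gradient n f (\<lambda>k. pd f k u) u"
proof -
  have "(\<Sum>k=1..n. pd f k u * w' k) = (\<Sum>k=1..n. f' k * w' k)" for w'
    by (intro sum.cong) (simp_all add: pd_eq_gradient[OF assms])
  then show ?thesis using assms unfolding has_gradient_def by simp
qed

section \<open>Calculus rules for gradients\<close>

lemma has_gradient_const: "has_gradient n (\<lambda>_. c) (\<lambda>_. 0) u"
  unfolding has_gradient_def by simp

lemma has_gradient_add:
  assumes "has_gradient n f f' u" "has_gradient n g g' u"
  shows "has_gradient n (\<lambda>v. f v + g v) (\<lambda>k. f' k + g' k) u"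
  using assms unfolding has_gradient_def
  by (auto simp: distrib_right sum.distrib intro!: DERIV_add)

lemma has_gradient_minus:
  assumes "has_gradient n f f' u"
  shows "has_gradient n (\<lambda>v. - f v) (\<lambda>k. - f' k) u"
  using assms unfolding has_gradient_def
  by (auto simp: sum_negf intro!: DERIV_minus)

lemma has_gradient_mult:
  assumes "has_gradient n f f' u" "has_gradient n g g' u"
  shows "has_gradient n (\<lambda>v. f v * g v) (\<lambda>k. f' k * g u + g' k * f u) u"
  unfolding has_gradient_def
proof (intro allI impI)
  fix w w' t
  assume w: "w t = u" "\<forall>k\<in>{1..n}. ((\<lambda>s. w s k) has_field_derivative w' k) (at t)"
  have "((\<lambda>s. f (w s) * g (w s)) has_field_derivative
      (\<Sum>k=1..n. f' k * w' k) * g (w t) + (\<Sum>k=1..n. g' k * w' k) * f (w t)) (at t)"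
    using assms w by (intro DERIV_mult has_gradientD) auto
  moreover have "(\<Sum>k=1..n. f' k * w' k) * g (w t) + (\<Sum>k=1..n. g' k * w' k) * f (w t)
      = (\<Sum>k=1..n. (f' k * g u + g' k * f u) * w' k)"
    by (simp add: w distrib_right distrib_left sum_distrib_left sum_distrib_right sum.distrib mult_ac)
  ultimately show "((\<lambda>s. f (w s) * g (w s)) has_field_derivative
      (\<Sum>k=1..n. (f' k * g u + g' k * f u) * w' k)) (at t)" by simp
qed

lemma has_gradient_sum:
  assumes "\<And>i. i \<in> I \<Longrightarrow> has_gradient n (f i) (f' i) u"
  shows "has_gradient n (\<lambda>v. \<Sum>i\<in>I. f i v) (\<lambda>k. \<Sum>i\<in>I. f' i k) u"
  using assms
  by (induction I rule: infinite_finite_induct) (auto intro: has_gradient_const has_gradient_add)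

text \<open>\<open>has_field_derivative_inverse_fun\<close> along a curve; the gradient is the
  familiar \<open>- h dG h\<close>. Nondegeneracy near \<open>t\<close> on each curve stands in for
  openness of the nondegenerate set.\<close>

lemma
  assumes G: "\<And>i j. i \<in> {1..n} \<Longrightarrow> j \<in> {1..n} \<Longrightarrow> has_gradient n (G i j) (G' i j) u"
    and h: "left_inverse n h (\<lambda>i j. G i j u)"
  shows eventually_nondeg:
    "w t = u \<Longrightarrow> (\<And>k. k \<in> {1..n} \<Longrightarrow> ((\<lambda>s. w s k) has_field_derivative w' k) (at t)) \<Longrightarrow>
      eventually (\<lambda>s. nondeg n G (w s)) (nhds t)"
    and has_gradient_cov: "i \<in> {1..n} \<Longrightarrow> j \<in> {1..n} \<Longrightarrow> has_gradient n (\<lambda>v. cov n G v i j)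
      (\<lambda>k. - (\<Sum>p=1..n. h i p * (\<Sum>q=1..n. G' p q k * h q j))) u"
proof -
  have M: "((\<lambda>s. G i j (w s)) has_field_derivative (\<Sum>k=1..n. G' i j k * w' k)) (at t)"
    if "w t = u" "\<And>k. k \<in> {1..n} \<Longrightarrow> ((\<lambda>s. w s k) has_field_derivative w' k) (at t)"
      "i \<in> {1..n}" "j \<in> {1..n}" for w w' t i j
    using G that by (intro has_gradientD) auto
  have h': "left_inverse n h (\<lambda>i j. G i j (w t))" if "w t = u" for w :: "complex \<Rightarrow> nat \<Rightarrow> complex" and t
    using h that by simp
  show "eventually (\<lambda>s. nondeg n G (w s)) (nhds t)"
    if w: "w t = u" "\<And>k. k \<in> {1..n} \<Longrightarrow> ((\<lambda>s. w s k) has_field_derivative w' k) (at t)" for w w' t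
  proof -
    have "eventually (\<lambda>s. left_inverse n (inverse_fun n (\<lambda>i j. G i j (w s))) (\<lambda>i j. G i j (w s))) (nhds t)"
      by (rule has_field_derivative_inverse_fun(1)[where M="\<lambda>s i j. G i j (w s)", OF M[of w t, OF w] h'[of w t, OF w(1)]])
    then show ?thesis
      by eventually_elim (auto simp: nondeg_iff)
  qed
  assume ij: "i \<in> {1..n}" "j \<in> {1..n}"
  show "has_gradient n (\<lambda>v. cov n G v i j)
      (\<lambda>k. - (\<Sum>p=1..n. h i p * (\<Sum>q=1..n. G' p q k * h q j))) u"
    unfolding has_gradient_def
  proof (intro allI impI)
    fix w w' t
    assume w: "w t = u" "\<forall>k\<in>{1..n}. ((\<lambda>s. w s k) has_field_derivative w' k) (at t)"
    have "((\<lambda>s. cov n G (w s) i j) has_field_derivative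
        - (\<Sum>p=1..n. h i p * (\<Sum>q=1..n. (\<Sum>k=1..n. G' p q k * w' k) * h q j))) (at t)"
      unfolding cov_eq_inverse_fun
      using w by (intro has_field_derivative_inverse_fun(2)[OF M h'] ij) auto
    moreover have "(\<Sum>p=1..n. h i p * (\<Sum>q=1..n. (\<Sum>k=1..n. G' p q k * w' k) * h q j))
        = (\<Sum>k=1..n. (\<Sum>p=1..n. h i p * (\<Sum>q=1..n. G' p q k * h q j)) * w' k)"
    proof -
      have "(\<Sum>q=1..n. (\<Sum>k=1..n. G' p q k * w' k) * h q j) = (\<Sum>k=1..n. (\<Sum>q=1..n. G' p q k * h q j) * w' k)" for p
        unfolding sum_distrib_right by (subst sum.swap) (simp only: mult.assoc mult.commute[of "h _ _"])
      then show ?thesis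
        by (simp add: sum_distrib_right sum_distrib_left mult.assoc) (rule sum.swap)
    qed
    ultimately show "((\<lambda>s. cov n G (w s) i j) has_field_derivative
        (\<Sum>k=1..n. - (\<Sum>p=1..n. h i p * (\<Sum>q=1..n. G' p q k * h q j)) * w' k)) (at t)"
      by (simp add: sum_negf)
  qed
qed

text \<open>Koszul's argument with raised indices. Lowering with \<open>h\<close> turns
  \<open>torsion\<close> into symmetry of \<open>L\<close> and \<open>metric\<close> into a formula
  for the derivatives of \<open>cov\<close>; the alternating sum in \<open>chr\<close> then
  collapses.\<close>

lemma christoffel_unique:
  assumes G: "\<And>i j. i \<in> {1..n} \<Longrightarrow> j \<in> {1..n} \<Longrightarrow> has_gradient n (G i j) (G' i j) u"
    and sym: "\<And>i j. i \<in> {1..n} \<Longrightarrow> j \<in> {1..n} \<Longrightarrow> G i j u = G j i u"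
    and h: "left_inverse n h (\<lambda>i j. G i j u)"
    and metric: "\<And>i j k. i \<in> {1..n} \<Longrightarrow> j \<in> {1..n} \<Longrightarrow> k \<in> {1..n} \<Longrightarrow> G' i j k = \<Gamma> i j k + \<Gamma> j i k"
    and torsion: "\<And>i j k. i \<in> {1..n} \<Longrightarrow> j \<in> {1..n} \<Longrightarrow> k \<in> {1..n} \<Longrightarrow>
      (\<Sum>s=1..n. G i s u * \<Gamma> j k s) = (\<Sum>s=1..n. G j s u * \<Gamma> i k s)"
  shows chr_unique: "\<And>j s k. j \<in> {1..n} \<Longrightarrow> s \<in> {1..n} \<Longrightarrow> k \<in> {1..n} \<Longrightarrow>
      chr n G j s k u = - (\<Sum>i=1..n. h s i * \<Gamma> i j k)"
    and cchr_unique: "\<And>i j k. i \<in> {1..n} \<Longrightarrow> j \<in> {1..n} \<Longrightarrow> k \<in> {1..n} \<Longrightarrow>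
      cchr n G i j k u = \<Gamma> i j k"
proof -
  define L where "L q m s = (\<Sum>p=1..n. h m p * \<Gamma> p q s)" for q m s
  have h_sym: "h i j = h j i" if "i \<in> {1..n}" "j \<in> {1..n}" for i j
    using left_inverse_symmetric[OF h sym] that by blast
  have L_sym: "L q m s = L q s m" if "q \<in> {1..n}" "m \<in> {1..n}" "s \<in> {1..n}" for q m s
  proof -
    \<comment> \<open>Inserting \<open>h\<close> times \<open>G\<close> at the index
      \<open>s\<close> exposes the left side of \<open>torsion\<close>.\<close>
    have "L q m s = (\<Sum>j=1..n. h m j * (\<Sum>i=1..n. h s i * (\<Sum>r=1..n. G i r u * \<Gamma> j q r)))"
      unfolding L_def using that by (simp add: left_inverse_cancel[OF h])
    also have "\<dots> = (\<Sum>i=1..n. h s i * (\<Sum>j=1..n. h m j * (\<Sum>r=1..n. G i r u * \<Gamma> j q r)))"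
      by (simp only: sum_distrib_left mult.left_commute) (rule sum.swap)
    also have "\<dots> = (\<Sum>i=1..n. h s i * (\<Sum>j=1..n. h m j * (\<Sum>r=1..n. G j r u * \<Gamma> i q r)))"
      using that by (intro sum.cong arg_cong2[where f="(*)"] refl torsion) auto
    also have "\<dots> = L q s m"
      unfolding L_def using that by (simp add: left_inverse_cancel[OF h])
    finally show ?thesis .
  qed
  have dh: "pd (\<lambda>v. cov n G v m k) s u
      = - (\<Sum>q=1..n. L q m s * h q k) - (\<Sum>q=1..n. L q k s * h m q)"
    if "m \<in> {1..n}" "k \<in> {1..n}" "s \<in> {1..n}" for m k s
  proof -
    have "pd (\<lambda>v. cov n G v m k) s u = - (\<Sum>p=1..n. h m p * (\<Sum>q=1..n. G' p q s * h q k))"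
      by (rule pd_eq_gradient[OF has_gradient_cov[OF G h]]) (use that in auto)
    also have "(\<Sum>p=1..n. h m p * (\<Sum>q=1..n. G' p q s * h q k))
       = (\<Sum>p=1..n. h m p * (\<Sum>q=1..n. \<Gamma> p q s * h q k)) + (\<Sum>p=1..n. h m p * (\<Sum>q=1..n. h k q * \<Gamma> q p s))"
    proof -
      have "(\<Sum>q=1..n. G' p q s * h q k) = (\<Sum>q=1..n. \<Gamma> p q s * h q k) + (\<Sum>q=1..n. h k q * \<Gamma> q p s)"
        if "p \<in> {1..n}" for p
        unfolding sum.distrib[symmetric]
        using that \<open>k \<in> _\<close> \<open>s \<in> _\<close>
        by (intro sum.cong) (auto simp: metric algebra_simps h_sym[of k])
      then show ?thesis by (simp add: distrib_left sum.distrib)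
    qed
    also have "(\<Sum>p=1..n. h m p * (\<Sum>q=1..n. \<Gamma> p q s * h q k)) = (\<Sum>q=1..n. L q m s * h q k)"
      unfolding L_def by (simp add: sum_distrib_right sum_distrib_left mult.assoc) (rule sum.swap)
    also have "(\<Sum>p=1..n. h m p * (\<Sum>q=1..n. h k q * \<Gamma> q p s)) = (\<Sum>q=1..n. L q k s * h m q)"
      unfolding L_def by (simp add: mult.commute)
    finally show ?thesis by simp
  qed
  show chr_eq: "chr n G j s k u = - (\<Sum>i=1..n. h s i * \<Gamma> i j k)"
    if jsk: "j \<in> {1..n}" "s \<in> {1..n}" "k \<in> {1..n}" for j s k
  proof -
    \<comment> \<open>Of the six sums given by \<open>dh\<close>, symmetry of \<open>L\<close> and
      \<open>h\<close> cancels two pairs and makes the remaining two equal.\<close>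
    have koszul: "pd (\<lambda>v. cov n G v m k) s u + pd (\<lambda>v. cov n G v m s) k u - pd (\<lambda>v. cov n G v s k) m u
        = - 2 * (\<Sum>q=1..n. h m q * L q s k)" if m: "m \<in> {1..n}" for m
    proof -
      have 1: "(\<Sum>q=1..n. L q s m * h q k) = (\<Sum>q=1..n. L q m s * h q k)"
        and 2: "(\<Sum>q=1..n. L q k m * h s q) = (\<Sum>q=1..n. L q m k * h q s)"
        and 3: "(\<Sum>q=1..n. L q k s * h m q) = (\<Sum>q=1..n. h m q * L q s k)"
        and 4: "(\<Sum>q=1..n. L q s k * h m q) = (\<Sum>q=1..n. h m q * L q s k)"
        using m jsk by (auto intro!: sum.cong simp: L_sym[of _ s m] L_sym[of _ k m] L_sym[of _ k s] h_sym[of s])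
      show ?thesis
        unfolding dh[OF m jsk(3,2)] dh[OF m jsk(2,3)] dh[OF jsk(2,3) m] 1 2 3 4 by simp
    qed
    have "chr n G j s k u = (1/2) * (\<Sum>m=1..n. G j m u * (- 2 * (\<Sum>q=1..n. h m q * L q s k)))"
      unfolding chr_def by (intro arg_cong2[where f="(*)"] sum.cong refl koszul)
    also have "\<dots> = - (\<Sum>m=1..n. G j m u * (\<Sum>q=1..n. h m q * L q s k))"
      by (simp add: sum_distrib_left sum_negf mult_ac)
    also have "\<dots> = - L j s k"
      using left_inverse_cancel[OF left_inverse_commute[OF h], of j "\<lambda>q. L q s k"] jsk by simp
    finally show ?thesis by (simp add: L_def)
  qed
  show "cchr n G i j k u = \<Gamma> i j k" if "i \<in> {1..n}" "j \<in> {1..n}" "k \<in> {1..n}" for i j k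
  proof -
    have "cchr n G i j k u = (\<Sum>s=1..n. G i s u * (\<Sum>p=1..n. h s p * \<Gamma> p j k))"
      unfolding cchr_def sum_negf[symmetric] using that by (intro sum.cong) (auto simp: chr_eq)
    then show ?thesis
      using left_inverse_cancel[OF left_inverse_commute[OF h], of i "\<lambda>p. \<Gamma> p j k"] that by simp
  qed
qed

text \<open>The definition of \<open>chr\<close> contains derivatives of \<open>cov\<close>. The
  closed formula avoids a second derivative: it holds at every nondegenerate point, hence near
  \<open>t\<close> on each curve, and is built from functions with known gradients.\<close>

lemma has_gradient_chr:
  assumes G: "\<And>i j. i \<in> {1..n} \<Longrightarrow> j \<in> {1..n} \<Longrightarrow> has_gradient n (G i j) (G' i j) u"
    and nd: "nondeg n G u"
    and \<Gamma>: "\<And>i j k. i \<in> {1..n} \<Longrightarrow> j \<in> {1..n} \<Longrightarrow> k \<in> {1..n} \<Longrightarrow> has_gradient n (\<Gamma> i j k) (\<Gamma>' i j k) u"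
    and chr: "\<And>v j s k. nondeg n G v \<Longrightarrow> j \<in> {1..n} \<Longrightarrow> s \<in> {1..n} \<Longrightarrow> k \<in> {1..n} \<Longrightarrow>
      chr n G j s k v = - (\<Sum>i=1..n. cov n G v s i * \<Gamma> i j k v)"
    and jsk: "j \<in> {1..n}" "s \<in> {1..n}" "k \<in> {1..n}"
  shows "has_gradient n (chr n G j s k) (\<lambda>m. pd (chr n G j s k) m u) u"
proof -
  define f where "f v = - (\<Sum>i=1..n. cov n G v s i * \<Gamma> i j k v)" for v
  have *: "has_gradient n (\<lambda>v. cov n G v s i * \<Gamma> i j k v) (\<lambda>m. pd (\<lambda>v. cov n G v s i * \<Gamma> i j k v) m u) u"
    if "i \<in> {1..n}" for i
    by (rule has_gradient_pd[OF has_gradient_mult[OF has_gradient_cov[OF G left_inverse_cov[OF nd]] \<Gamma>]])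
      (use that jsk in auto)
  have "\<exists>f'. has_gradient n f f' u"
    unfolding f_def by (rule exI, rule has_gradient_minus, rule has_gradient_sum, rule *)
  then obtain f' where f': "has_gradient n f f' u" ..
  have "has_gradient n (chr n G j s k) f' u"
    unfolding has_gradient_def
  proof (intro allI impI)
    fix w w' t
    assume w: "w t = u" "\<forall>m\<in>{1..n}. ((\<lambda>r. w r m) has_field_derivative w' m) (at t)"
    have "eventually (\<lambda>r. nondeg n G (w r)) (nhds t)"
      by (rule eventually_nondeg[OF G left_inverse_cov[OF nd], of w t w']) (use w in auto)
    then have "eventually (\<lambda>r. f (w r) = chr n G j s k (w r)) (nhds t)"
      by eventually_elim (simp add: f_def chr[OF _ jsk])
    moreover have "((\<lambda>r. f (w r)) has_field_derivative (\<Sum>m=1..n. f' m * w' m)) (at t)"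
      by (rule has_gradientD) (use f' w in auto)
    ultimately show "((\<lambda>r. chr n G j s k (w r)) has_field_derivative (\<Sum>m=1..n. f' m * w' m)) (at t)"
      by (rule has_field_derivative_cong_nhds[rotated])
  qed
  then show ?thesis by (rule has_gradient_pd)
qed

section \<open>Elementary symmetric polynomials\<close>

text \<open>The form \<open>B\<^sub>i\<^sub>j\<close> of the introduction with both indices lowered by one, obtained by
  extracting coefficients from the generating functions of \<open>g\<close> and \<open>\<Gamma>\<close>.\<close>
definition bform :: "nat \<Rightarrow> nat \<Rightarrow> nat \<Rightarrow> (nat \<Rightarrow> complex) \<Rightarrow> (nat \<Rightarrow> complex) \<Rightarrow> complex" where
  "bform n i j e d = (of_nat n - of_nat i - 1) * (of_nat n - of_nat j) * e i * d j
     + (\<Sum>m=1..i. (of_nat m + of_nat j - of_nat i) * e (i - m) * d (j + m)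
                 + of_nat m * e (j + m) * d (i - m))"

text \<open>The sum with upper limit \<open>i + k\<close> is cut after \<open>k\<close> terms. The
  tail, shifted by \<open>k\<close>, is the sum on the right. The head collapses under
  \<open>m\<close> to \<open>k - m\<close> to \<open>k * e (i + k) * d i\<close>, and
  \<open>(n-i-k-1)(n-i) + k = (n-i-1)(n-i-k)\<close> matches the leading terms.\<close>

lemma bform_swap_le: "bform n (i + k) i e d = bform n i (i + k) d e"
proof -
  define f where "f m = (of_nat m - of_nat k) * e (i + k - m) * d (i + m)
      + of_nat m * e (i + m) * d (i + k - m)" for m
  have "(\<Sum>m=1..i + k. (of_nat m + of_nat i - of_nat (i + k)) * e (i + k - m) * d (i + m)
      + of_nat m * e (i + m) * d (i + k - m)) = (\<Sum>m=1..k + i. f m)"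
    by (simp add: f_def add.commute)
  also have "\<dots> = (\<Sum>m=1..k. f m) + (\<Sum>m=1+k..i+k. f m)"
    using sum.ub_add_nat[of 1 k f i] by (simp add: add.commute)
  also have "(\<Sum>m=1+k..i+k. f m) = (\<Sum>m=1..i. f (m + k))"
    by (rule sum.shift_bounds_cl_nat_ivl)
  also have "(\<Sum>m=1..k. f m) = of_nat k * e (i + k) * d i"
  proof -
    let ?g = "\<lambda>m. of_nat m * e (i + m) * d (i + k - m)"
    have "(\<Sum>m=1..k. ?g m) = (\<Sum>m=0..k. ?g m)"
      by (simp add: sum.atLeast_Suc_atMost[of 0 k] One_nat_def)
    also have "\<dots> = (\<Sum>m=0..k. ?g (k - m))"
      using sum.atLeastAtMost_rev[of ?g 0 k] by simp
    also have "\<dots> = of_nat k * e (i + k) * d i + (\<Sum>m=1..k. ?g (k - m))"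
      by (simp add: sum.atLeast_Suc_atMost[of 0 k] One_nat_def)
    also have "(\<Sum>m=1..k. ?g (k - m)) = (\<Sum>m=1..k. - ((of_nat m - of_nat k) * e (i + k - m) * d (i + m)))"
      by (intro sum.cong) (auto simp: of_nat_diff algebra_simps)
    finally show ?thesis
      by (simp add: f_def sum.distrib sum_negf)
  qed
  finally show ?thesis
    unfolding bform_def
    by (simp add: f_def algebra_simps)
qed

lemma bform_swap: "bform n j i e d = bform n i j d e"
proof (cases "i \<le> j")
  case True
  then show ?thesis using bform_swap_le[of n i "j - i" e d] by simp
next
  case False
  then show ?thesis using bform_swap_le[of n j "i - j" d e] by simp
qed

text \<open>Once aligned, the weights of the two sums differ by the constant 1, so an unweighted sum
  remains. This drives the inductions on \<open>i\<close> in \<open>bform_esym\<close> and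
  \<open>bform_esym1\<close>.\<close>

lemma bform_Suc:
  "bform n (Suc i) j e d - bform n i (Suc j) e d
   = (of_nat n - of_nat i - 2) * (of_nat n - of_nat j) * e (Suc i) * d j
   - (of_nat n - of_nat i - 1) * (of_nat n - of_nat j - 1) * e i * d (Suc j)
   + (of_nat j - of_nat i + 1) * e i * d (Suc j)
   + (\<Sum>m\<le>i. e (Suc (j + m)) * d (i - m) - e (i - m) * d (Suc (j + m)))"
proof -
  define f where "f m = (of_nat m + of_nat j - of_nat i) * e (i - m) * d (Suc (j + m))
                 + (of_nat m + 1) * e (Suc (j + m)) * d (i - m)" for m
  define g where "g m = (of_nat m + of_nat (Suc j) - of_nat i) * e (i - m) * d (Suc j + m)
                 + of_nat m * e (Suc j + m) * d (i - m)" for m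
  have "(\<Sum>m=1..Suc i. (of_nat m + of_nat j - of_nat (Suc i)) * e (Suc i - m) * d (j + m)
                 + of_nat m * e (j + m) * d (Suc i - m)) = (\<Sum>m\<le>i. f m)"
    by (rule sum.reindex_bij_witness[of _ Suc "\<lambda>m. m - 1"]) (auto simp: f_def Suc_diff_le of_nat_diff One_nat_def algebra_simps)
  moreover have "(\<Sum>m=1..i. g m) = (\<Sum>m\<le>i. g m) - g 0"
    by (simp add: atMost_atLeast0 sum.atLeast_Suc_atMost[of 0 i] One_nat_def)
  moreover have "(\<Sum>m\<le>i. f m) - (\<Sum>m\<le>i. g m)
      = (\<Sum>m\<le>i. e (Suc (j + m)) * d (i - m) - e (i - m) * d (Suc (j + m)))"
    unfolding sum_subtractf[symmetric] f_def g_def by (intro sum.cong) (auto simp: algebra_simps)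
  ultimately show ?thesis
    unfolding bform_def g_def[symmetric]
    by (simp add: algebra_simps) (simp add: g_def algebra_simps)
qed

section \<open>The generating polynomial, its coefficients and its roots\<close>

text \<open>Generating polynomial of the elementary symmetric polynomials in the variables \<open>x i\<close>, \<open>i \<in> A\<close>.\<close>
definition linpoly :: "nat set \<Rightarrow> (nat \<Rightarrow> complex) \<Rightarrow> complex poly" where
  "linpoly A x = (\<Prod>i\<in>A. [:1, x i:])"

lemma linpoly_remove: "finite A \<Longrightarrow> a \<in> A \<Longrightarrow> linpoly A x = [:1, x a:] * linpoly (A - {a}) x"
  unfolding linpoly_def by (rule prod.remove)

lemma linpoly_cong: "(\<And>i. i \<in> A \<Longrightarrow> x i = y i) \<Longrightarrow> linpoly A x = linpoly A y"
  unfolding linpoly_def by simp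

lemma coeff_linear_mult: "coeff ([:1, c:] * q) k = coeff q k + c * coeff (pCons 0 q) k"
  for c :: complex
  by (cases k) (auto simp: coeff_pCons)

lemma coeff_linpoly_remove:
  assumes "finite A" "a \<in> A"
  shows "coeff (linpoly A x) k = coeff (linpoly (A - {a}) x) k + x a * coeff (pCons 0 (linpoly (A - {a}) x)) k"
  by (simp only: linpoly_remove[OF assms] coeff_linear_mult)

text \<open>The factor of index \<open>a\<close> occurs once, so the coefficients are affine in
  \<open>x a\<close>; the slope comes from the other factors, shifted by one degree.\<close>

lemma has_field_derivative_coeff_linpoly:
  assumes "finite A"
  shows "((\<lambda>t. coeff (linpoly A (x(a := t))) k) has_field_derivative
    (if a \<in> A then coeff (pCons 0 (linpoly (A - {a}) x)) k else 0)) (at s)"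
proof (cases "a \<in> A")
  case True
  have "linpoly (A - {a}) (x(a := t)) = linpoly (A - {a}) x" for t
    by (rule linpoly_cong) auto
  then have "coeff (linpoly A (x(a := t))) k
      = coeff (linpoly (A - {a}) x) k + t * coeff (pCons 0 (linpoly (A - {a}) x)) k" for t
    using coeff_linpoly_remove[OF assms True, of "x(a := t)"] by simp
  then show ?thesis using True by (auto intro!: derivative_eq_intros)
next
  case False
  then have "linpoly A (x(a := t)) = linpoly A x" for t
    by (intro linpoly_cong) auto
  then show ?thesis using False by simp
qed

lemma coeff_linpoly_0: "coeff (linpoly A x) 0 = 1"
  unfolding linpoly_def by (simp add: poly_0_coeff_0[symmetric] poly_prod)

lemma degree_linpoly: "finite A \<Longrightarrow> degree (linpoly A x) \<le> card A"
proof (induction rule: finite_induct)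
  case (insert a A)
  have "linpoly (insert a A) x = [:1, x a:] * linpoly A x"
    using insert unfolding linpoly_def by simp
  moreover have "degree ([:1, x a:] * linpoly A x) \<le> degree [:1, x a:] + degree (linpoly A x)"
    by (rule degree_mult_le)
  moreover have "degree [:1, x a:] \<le> 1" by (simp add: One_nat_def)
  ultimately show ?case using insert by simp
qed (simp add: linpoly_def)

text \<open>Roots are split off one at a time. A root \<open>r\<close> is nonzero because the
  constant coefficient is 1, so its factor normalises to \<open>1 - X / r\<close>. A degree below
  \<open>n\<close> is made up with variables equal to 0.\<close>

lemma linpoly_surj:
  assumes "degree q \<le> n" "coeff q 0 = 1"
  shows "\<exists>x. q = linpoly {1..n} x"
  using assms
proof (induction n arbitrary: q)
  case 0
  then show ?case by (auto simp: linpoly_def elim!: degree_eq_zeroE)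
next
  case (Suc n)
  show ?case
  proof (cases "degree q = 0")
    case True
    then have "q = linpoly {1..Suc n} (\<lambda>_. 0)"
      using Suc.prems(2) by (auto simp: linpoly_def one_pCons[symmetric] elim!: degree_eq_zeroE)
    then show ?thesis by blast
  next
    case False
    then obtain r where r: "poly q r = 0"
      using fundamental_theorem_of_algebra[of q] constant_degree[of q] by auto
    then obtain q1 where q1: "q = [:- r, 1:] * q1"
      by (auto simp: poly_eq_0_iff_dvd)
    define q2 where "q2 = Polynomial.smult (- r) q1"
    have r0: "r \<noteq> 0" using r Suc.prems(2) by (auto simp: poly_0_coeff_0)
    have q: "q = [:1, - 1 / r:] * q2"
    proof -
      have "[:- r, 1:] = Polynomial.smult (- r) [:1, - 1 / r:]" using r0 by simp
      then show ?thesis by (simp only: q1 q2_def mult_smult_left mult_smult_right)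
    qed
    have "q1 \<noteq> 0" using Suc.prems(2) q1 by auto
    then have "degree q = Suc (degree q1)" unfolding q1 by (subst degree_mult_eq) auto
    then have "degree q2 \<le> n" using Suc.prems(1) by (simp add: q2_def)
    moreover have "coeff q2 0 = 1" using Suc.prems(2) q by (simp add: coeff_mult_0)
    ultimately obtain x where "q2 = linpoly {1..n} x" using Suc.IH by blast
    moreover have "linpoly {1..n} (x(Suc n := - 1 / r)) = linpoly {1..n} x"
      by (rule linpoly_cong) auto
    ultimately have "q = linpoly {1..Suc n} (x(Suc n := - 1 / r))"
      using linpoly_remove[of "{1..Suc n}" "Suc n" "x(Suc n := - 1 / r)"]
      by (simp add: q atLeastAtMostSuc_conv)
    then show ?thesis by blast
  qed
qed

text \<open>Ties the generating polynomial to the subset sums of \<open>usym\<close>: the expanded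
  product has one monomial of degree \<open>card S\<close> for each subset \<open>S\<close>.\<close>

lemma coeff_linpoly_eq_sum:
  assumes "finite A"
  shows "coeff (linpoly A x) k = (\<Sum>S\<in>{S. S \<subseteq> A \<and> card S = k}. \<Prod>i\<in>S. x i)"
proof -
  have monom: "(\<Prod>i\<in>S. monom (x i) 1) = monom (\<Prod>i\<in>S. x i) (card S)" if "finite S" for S
    using that by (induction S rule: finite_induct) (auto simp: mult_monom One_nat_def)
  have "linpoly A x = (\<Prod>i\<in>A. monom (x i) 1 + 1)"
    unfolding linpoly_def by (intro prod.cong) (auto simp: monom_altdef one_pCons)
  also have "\<dots> = (\<Sum>S\<in>Pow A. monom (\<Prod>i\<in>S. x i) (card S))"
    unfolding prod_add[OF assms] using assms by (intro sum.cong) (auto simp: monom finite_subset)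
  finally have "coeff (linpoly A x) k = (\<Sum>S\<in>Pow A. if card S = k then \<Prod>i\<in>S. x i else 0)"
    by (simp add: coeff_sum)
  also have "\<dots> = (\<Sum>S\<in>{S \<in> Pow A. card S = k}. \<Prod>i\<in>S. x i)"
    using assms by (intro sum.inter_filter[symmetric]) simp
  finally show ?thesis by simp
qed

text \<open>\<open>esym1\<close>, \<open>esym2\<close> and \<open>esym3\<close> are the partial derivatives of order one to three of \<open>esym\<close>;
  the first indices are the variables of differentiation.\<close>
definition esym :: "nat \<Rightarrow> nat \<Rightarrow> (nat \<Rightarrow> complex) \<Rightarrow> complex" where
  "esym n k x = coeff (linpoly {1..n} x) k"

definition esym1 :: "nat \<Rightarrow> nat \<Rightarrow> nat \<Rightarrow> (nat \<Rightarrow> complex) \<Rightarrow> complex" where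
  "esym1 n a k x = coeff (pCons 0 (linpoly ({1..n} - {a}) x)) k"

definition esym2 :: "nat \<Rightarrow> nat \<Rightarrow> nat \<Rightarrow> nat \<Rightarrow> (nat \<Rightarrow> complex) \<Rightarrow> complex" where
  "esym2 n a b k x = (if a = b then 0 else
     coeff (pCons 0 (pCons 0 (linpoly ({1..n} - {a} - {b}) x))) k)"

definition esym3 :: "nat \<Rightarrow> nat \<Rightarrow> nat \<Rightarrow> nat \<Rightarrow> nat \<Rightarrow> (nat \<Rightarrow> complex) \<Rightarrow> complex" where
  "esym3 n a b c k x = (if a = b \<or> a = c \<or> b = c then 0 else
     coeff (pCons 0 (pCons 0 (pCons 0 (linpoly ({1..n} - {a} - {b} - {c}) x)))) k)"

section \<open>Recurrences and sums for the derivatives of \<open>esym\<close>\<close>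

lemma esym2_commute: "esym2 n a b k x = esym2 n b a k x"
  unfolding esym2_def by (simp add: insert_commute Diff_insert2[symmetric])

lemma esym3_commute: "esym3 n a b c k x = esym3 n b a c k x"
  unfolding esym3_def by (auto simp: insert_commute Diff_insert2[symmetric])

lemma esym_0: "esym n 0 x = 1"
  unfolding esym_def by (rule coeff_linpoly_0)

lemma esym_gt: "k > n \<Longrightarrow> esym n k x = 0"
  unfolding esym_def using degree_linpoly[of "{1..n}" x] by (intro coeff_eq_0) simp

lemma esym1_0: "esym1 n a 0 x = 0"
  unfolding esym1_def by simp

lemma esym1_1: "esym1 n a (Suc 0) x = 1"
  unfolding esym1_def by (simp add: coeff_linpoly_0)

lemma esym1_gt: "a \<in> {1..n} \<Longrightarrow> k > n \<Longrightarrow> esym1 n a k x = 0"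
  unfolding esym1_def using degree_linpoly[of "{1..n} - {a}" x]
  by (cases k) (auto intro!: coeff_eq_0)

lemma deriv_esym:
  assumes "a \<in> {1..n}"
  shows "((\<lambda>t. esym n k (x(a := t))) has_field_derivative esym1 n a k x) (at s)"
  using has_field_derivative_coeff_linpoly[of "{1..n}" x a k s] assms
  unfolding esym_def esym1_def by simp

lemma deriv_esym1:
  assumes "a \<in> {1..n}"
  shows "((\<lambda>t. esym1 n b k (x(a := t))) has_field_derivative esym2 n a b k x) (at s)"
proof (cases k)
  case (Suc m)
  show ?thesis
    using has_field_derivative_coeff_linpoly[of "{1..n} - {b}" x a m s] assms
    unfolding esym1_def esym2_def Suc by (auto simp: insert_commute Diff_insert2[symmetric])
qed (simp add: esym1_def esym2_def)

lemma deriv_esym2: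
  assumes "a \<in> {1..n}"
  shows "((\<lambda>t. esym2 n b c k (x(a := t))) has_field_derivative esym3 n a b c k x) (at s)"
proof (cases "b = c \<or> k < 2")
  case True
  then show ?thesis
    by (cases "b = c") (auto simp: esym2_def esym3_def less_2_cases_iff One_nat_def coeff_pCons)
next
  case False
  then obtain m where k: "k = Suc (Suc m)"
    by (metis add_2_eq_Suc le_Suc_ex not_less)
  have set: "{1..n} - {a} - {b} - {c} = {1..n} - {b} - {c} - {a}" by blast
  show ?thesis
    using has_field_derivative_coeff_linpoly[of "{1..n} - {b} - {c}" x a m s] assms False
    unfolding esym3_def esym2_def k set by auto
qed

lemma esym1_Suc: "a \<in> {1..n} \<Longrightarrow> esym1 n a (Suc k) x = esym n k x - x a * esym1 n a k x"
  using coeff_linpoly_remove[of "{1..n}" a x k] unfolding esym_def esym1_def by simp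

text \<open>Corresponds to differentiating the recurrence \<open>esym1_Suc\<close> for
  \<open>b\<close> in the variable \<open>a\<close>; the case \<open>a = b\<close> accounts for the
  factor \<open>x b\<close>.\<close>

lemma esym2_Suc:
  assumes "a \<in> {1..n}" "b \<in> {1..n}"
  shows "esym2 n a b (Suc k) x
    = esym1 n a k x - (if a = b then esym1 n a k x else 0) - x b * esym2 n a b k x"
proof (cases k)
  case (Suc m)
  then show ?thesis
    using coeff_linpoly_remove[of "{1..n} - {a}" b x m] assms
    unfolding esym2_def esym1_def by auto
qed (simp add: esym2_def esym1_def)

text \<open>Euler's identity for a homogeneous polynomial of degree \<open>k\<close>, read off from
  the derivative of the generating polynomial, combined with \<open>esym1_Suc\<close>.\<close>

lemma sum_esym1: "(\<Sum>b=1..n. esym1 n b (Suc k) x) = (of_nat n - of_nat k) * esym n k x"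
proof -
  have "(\<Sum>b=1..n. x b * esym1 n b k x) = of_nat k * esym n k x"
  proof (cases k)
    case (Suc m)
    have "pderiv (linpoly {1..n} x) = (\<Sum>b=1..n. Polynomial.smult (x b) (linpoly ({1..n} - {b}) x))"
      unfolding linpoly_def pderiv_prod by (simp add: pderiv_pCons)
    then have "coeff (pderiv (linpoly {1..n} x)) m = (\<Sum>b=1..n. x b * esym1 n b k x)"
      by (simp add: coeff_sum esym1_def Suc)
    then show ?thesis by (simp add: coeff_pderiv esym_def Suc)
  qed (simp add: esym1_0)
  moreover have "(\<Sum>b=1..n. esym1 n b (Suc k) x) = (\<Sum>b=1..n. esym n k x - x b * esym1 n b k x)"
    by (intro sum.cong) (auto simp: esym1_Suc)
  ultimately show ?thesis by (simp add: sum_subtractf left_diff_distrib)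
qed

text \<open>The identity \<open>sum_esym1\<close> differentiated in \<open>x a\<close>.\<close>

lemma sum_esym2:
  assumes "a \<in> {1..n}"
  shows "(\<Sum>b=1..n. esym2 n a b (Suc k) x) = (of_nat n - of_nat k) * esym1 n a k x"
proof (rule DERIV_unique)
  show "((\<lambda>t. \<Sum>b=1..n. esym1 n b (Suc k) (x(a := t))) has_field_derivative
      (\<Sum>b=1..n. esym2 n a b (Suc k) x)) (at (x a))"
    by (intro DERIV_sum deriv_esym1 assms)
  show "((\<lambda>t. \<Sum>b=1..n. esym1 n b (Suc k) (x(a := t))) has_field_derivative
      (of_nat n - of_nat k) * esym1 n a k x) (at (x a))"
    unfolding sum_esym1 by (intro DERIV_cmult deriv_esym assms)
qed

lemma esym1_mult_Suc:
  assumes "a \<in> {1..n}"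
  shows "esym1 n a (Suc i) x * esym1 n a j x
    = esym1 n a i x * esym1 n a (Suc j) x + esym n i x * esym1 n a j x - esym n j x * esym1 n a i x"
  by (simp add: esym1_Suc[OF assms] algebra_simps)

text \<open>Iterates \<open>esym1_mult_Suc\<close>. Up to sign, the sum is the unweighted one left
  over in \<open>bform_Suc\<close> for the arguments \<open>esym\<close> and
  \<open>esym1\<close>.\<close>

lemma esym1_mult:
  assumes "a \<in> {1..n}"
  shows "esym1 n a (Suc i) x * esym1 n a (Suc j) x = (\<Sum>m\<le>i. esym n (i - m) x * esym1 n a (Suc (j + m)) x
    - esym n (Suc (j + m)) x * esym1 n a (i - m) x)"
proof (induction i arbitrary: j)
  case 0
  then show ?case by (simp add: esym1_0 esym1_1 esym_0)
next
  case (Suc i)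
  show ?case
    unfolding sum.atMost_Suc_shift esym1_mult_Suc[OF assms, of "Suc i"] Suc.IH
    by simp
qed

text \<open>By \<open>sum_esym1\<close> the right side is the sum of
  \<open>esym1 n a (Suc i) x * esym1 n b (Suc j) x\<close> over \<open>a \<noteq> b\<close>. In the
  induction step \<open>bform_Suc\<close> and \<open>esym1_mult_Suc\<close> change both sides alike;
  the leftover \<open>W\<close> vanishes because both arguments are equal.\<close>

lemma bform_esym:
  "bform n i j (\<lambda>k. esym n k x) (\<lambda>k. esym n k x)
    = (of_nat n - of_nat i) * (of_nat n - of_nat j) * esym n i x * esym n j x
      - (\<Sum>b=1..n. esym1 n b (Suc i) x * esym1 n b (Suc j) x)"
proof (induction i arbitrary: j)
  case 0
  show ?case by (simp add: bform_def esym_0 esym1_1 sum_esym1 algebra_simps)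
next
  case (Suc i)
  have "(\<Sum>b=1..n. esym1 n b (Suc (Suc i)) x * esym1 n b (Suc j) x)
     = (\<Sum>b=1..n. esym1 n b (Suc i) x * esym1 n b (Suc (Suc j)) x + esym n (Suc i) x * esym1 n b (Suc j) x
        - esym n (Suc j) x * esym1 n b (Suc i) x)"
    by (intro sum.cong) (auto simp: esym1_mult_Suc[of _ n "Suc i"])
  also have "\<dots> = (\<Sum>b=1..n. esym1 n b (Suc i) x * esym1 n b (Suc (Suc j)) x)
     + esym n (Suc i) x * ((of_nat n - of_nat j) * esym n j x)
     - esym n (Suc j) x * ((of_nat n - of_nat i) * esym n i x)"
    by (simp add: sum.distrib sum_subtractf sum_distrib_left[symmetric] sum_esym1)
  finally have Q: "(\<Sum>b=1..n. esym1 n b (Suc (Suc i)) x * esym1 n b (Suc j) x)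
     = (\<Sum>b=1..n. esym1 n b (Suc i) x * esym1 n b (Suc (Suc j)) x)
     + esym n (Suc i) x * ((of_nat n - of_nat j) * esym n j x)
     - esym n (Suc j) x * ((of_nat n - of_nat i) * esym n i x)" .
  have W: "(\<Sum>m\<le>i. esym n (Suc (j + m)) x * esym n (i - m) x - esym n (i - m) x * esym n (Suc (j + m)) x) = 0"
    by (simp add: mult.commute)
  from bform_Suc[of n i j "\<lambda>k. esym n k x" "\<lambda>k. esym n k x"] Suc.IH[of "Suc j"] W show ?case
    unfolding Q by (simp add: algebra_simps)
qed

text \<open>The same induction with the second argument differentiated in \<open>x a\<close>. The
  leftover \<open>W\<close> need not vanish; by \<open>esym1_mult\<close> it matches the product
  produced by the \<open>a = b\<close> term of \<open>esym2_Suc\<close>.\<close>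

lemma bform_esym1:
  assumes "a \<in> {1..n}"
  shows "bform n i j (\<lambda>k. esym n k x) (\<lambda>k. esym1 n a k x)
    = (of_nat n - of_nat i) * (of_nat n - of_nat j) * esym n i x * esym1 n a j x
      - (\<Sum>b=1..n. esym1 n b (Suc i) x * esym2 n a b (Suc j) x)"
proof (induction i arbitrary: j)
  case 0
  show ?case by (simp add: bform_def esym_0 esym1_1 sum_esym2[OF assms] algebra_simps)
next
  case (Suc i)
  have step: "esym1 n b (Suc (Suc i)) x * esym2 n a b (Suc j) x
      = esym1 n b (Suc i) x * esym2 n a b (Suc (Suc j)) x + esym n (Suc i) x * esym2 n a b (Suc j) x
        - esym1 n a (Suc j) x * esym1 n b (Suc i) x
        + (if a = b then esym1 n a (Suc i) x * esym1 n a (Suc j) x else 0)"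
    if "b \<in> {1..n}" for b
    unfolding esym2_Suc[OF assms that, of "Suc j"] esym1_Suc[OF that, of "Suc i"]
    by (auto simp: algebra_simps)
  have "(\<Sum>b=1..n. esym1 n b (Suc (Suc i)) x * esym2 n a b (Suc j) x)
     = (\<Sum>b=1..n. esym1 n b (Suc i) x * esym2 n a b (Suc (Suc j)) x + esym n (Suc i) x * esym2 n a b (Suc j) x
        - esym1 n a (Suc j) x * esym1 n b (Suc i) x
        + (if a = b then esym1 n a (Suc i) x * esym1 n a (Suc j) x else 0))"
    by (intro sum.cong refl step)
  also have "\<dots> = (\<Sum>b=1..n. esym1 n b (Suc i) x * esym2 n a b (Suc (Suc j)) x)
     + esym n (Suc i) x * ((of_nat n - of_nat j) * esym1 n a j x)
     - esym1 n a (Suc j) x * ((of_nat n - of_nat i) * esym n i x)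
     + esym1 n a (Suc i) x * esym1 n a (Suc j) x"
    using assms
    by (simp add: sum.distrib sum_subtractf sum_distrib_left[symmetric] sum_esym1 sum_esym2)
  finally have Q: "(\<Sum>b=1..n. esym1 n b (Suc (Suc i)) x * esym2 n a b (Suc j) x)
     = (\<Sum>b=1..n. esym1 n b (Suc i) x * esym2 n a b (Suc (Suc j)) x)
     + esym n (Suc i) x * ((of_nat n - of_nat j) * esym1 n a j x)
     - esym1 n a (Suc j) x * ((of_nat n - of_nat i) * esym n i x)
     + esym1 n a (Suc i) x * esym1 n a (Suc j) x" .
  have W: "(\<Sum>m\<le>i. esym n (Suc (j + m)) x * esym1 n a (i - m) x - esym n (i - m) x * esym1 n a (Suc (j + m)) x)
      = - (esym1 n a (Suc i) x * esym1 n a (Suc j) x)"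
    unfolding esym1_mult[OF assms] sum_negf[symmetric] by (intro sum.cong) auto
  from bform_Suc[of n i j "\<lambda>k. esym n k x" "\<lambda>k. esym1 n a k x"] Suc.IH[of "Suc j"] show ?case
    unfolding Q W by (simp add: algebra_simps)
qed

section \<open>The flat metric and its Christoffel symbols\<close>

text \<open>If \<open>J\<close> is the Jacobian of a change of coordinates with first derivatives \<open>H\<close> and second derivatives
  \<open>T\<close>, the first premise on \<open>C\<close> says that the connection \<open>C\<close> vanishes in the new coordinates, and the
  second one is its derivative.\<close>
lemma curvature_pullback_zero:
  fixes C :: "nat \<Rightarrow> nat \<Rightarrow> nat \<Rightarrow> complex" and C' :: "nat \<Rightarrow> nat \<Rightarrow> nat \<Rightarrow> nat \<Rightarrow> complex"
  assumes K: "left_inverse n K J"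
    and C: "\<And>a p q. a \<in> {1..n} \<Longrightarrow> p \<in> {1..n} \<Longrightarrow> q \<in> {1..n} \<Longrightarrow>
      (\<Sum>d=1..n. \<Sum>b=1..n. C a d b * J p d * J q b) = - H p q a"
    and C': "\<And>a r p q. a \<in> {1..n} \<Longrightarrow> r \<in> {1..n} \<Longrightarrow> p \<in> {1..n} \<Longrightarrow> q \<in> {1..n} \<Longrightarrow>
      (\<Sum>d=1..n. \<Sum>b=1..n. (\<Sum>c=1..n. C' a d b c * J r c) * J p d * J q b
         + C a d b * H r p d * J q b + C a d b * J p d * H r q b) = - T r p q a"
    and H: "\<And>p q a. H p q a = H q p a" and T: "\<And>r p q a. T r p q a = T p r q a"
    and idx: "a \<in> {1..n}" "b \<in> {1..n}" "c \<in> {1..n}" "d \<in> {1..n}"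
  shows "C' a d b c - C' a c b d + (\<Sum>e=1..n. C a c e * C e d b - C a d e * C e c b) = 0"
proof -
  define R where "R c d b = C' a d b c - C' a c b d + (\<Sum>e=1..n. C a c e * C e d b - C a d e * C e c b)" for c d b
  \<comment> \<open>In the contractions with \<open>J\<close>, the terms \<open>T\<close> and
    \<open>S\<close> are symmetric in \<open>r\<close> and \<open>p\<close> and drop out of the
    curvature, while the \<open>Q\<close> terms cancel against the quadratic part.\<close>
  define X where "X r p q = (\<Sum>c=1..n. J r c * (\<Sum>d=1..n. J p d * (\<Sum>b=1..n. J q b * C' a d b c)))" for r p q
  define Q where "Q r p q = (\<Sum>d=1..n. \<Sum>b=1..n. C a d b * J p d * H r q b)" for r p q
  define S where "S r p q = (\<Sum>d=1..n. \<Sum>b=1..n. C a d b * H r p d * J q b)" for r p q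
  have X: "X r p q = - T r p q a - S r p q - Q r p q" if "r \<in> {1..n}" "p \<in> {1..n}" "q \<in> {1..n}" for r p q
  proof -
    have "X r p q = (\<Sum>d=1..n. \<Sum>c=1..n. J r c * (J p d * (\<Sum>b=1..n. J q b * C' a d b c)))"
      unfolding X_def sum_distrib_left by (rule sum.swap)
    also have "\<dots> = (\<Sum>d=1..n. \<Sum>b=1..n. \<Sum>c=1..n. J r c * (J p d * (J q b * C' a d b c)))"
      unfolding sum_distrib_left by (intro sum.cong refl sum.swap)
    also have "\<dots> = (\<Sum>d=1..n. \<Sum>b=1..n. (\<Sum>c=1..n. C' a d b c * J r c) * J p d * J q b)"
      unfolding sum_distrib_right by (intro sum.cong refl) (simp add: mult_ac)
    finally show ?thesis
      using C'[OF idx(1) that] unfolding S_def Q_def by (simp add: sum.distrib algebra_simps)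
  qed
  have X_swap: "(\<Sum>c=1..n. J r c * (\<Sum>d=1..n. J p d * (\<Sum>b=1..n. J q b * C' a c b d))) = X p r q" for r p q
    unfolding X_def sum_distrib_left by (subst sum.swap) (simp add: mult_ac)
  have quad: "(\<Sum>c=1..n. J r c * (\<Sum>d=1..n. J p d * (\<Sum>b=1..n. J q b * (\<Sum>e=1..n. C a c e * C e d b))))
      = - Q p r q" if "r \<in> {1..n}" "p \<in> {1..n}" "q \<in> {1..n}" for r p q
  proof -
    have *: "(\<Sum>d=1..n. J p d * (\<Sum>b=1..n. J q b * (\<Sum>e=1..n. C a c e * C e d b)))
        = (\<Sum>e=1..n. C a c e * - H p q e)" for c
    proof -
      have "(\<Sum>d=1..n. J p d * (\<Sum>b=1..n. J q b * (\<Sum>e=1..n. C a c e * C e d b)))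
        = (\<Sum>d=1..n. \<Sum>e=1..n. \<Sum>b=1..n. J p d * (J q b * (C a c e * C e d b)))"
        unfolding sum_distrib_left by (intro sum.cong refl sum.swap)
      also have "\<dots> = (\<Sum>e=1..n. \<Sum>d=1..n. \<Sum>b=1..n. J p d * (J q b * (C a c e * C e d b)))"
        by (rule sum.swap)
      also have "\<dots> = (\<Sum>e=1..n. C a c e * (\<Sum>d=1..n. \<Sum>b=1..n. C e d b * J p d * J q b))"
        unfolding sum_distrib_left by (intro sum.cong refl) (simp add: mult_ac)
      also have "\<dots> = (\<Sum>e=1..n. C a c e * - H p q e)"
        using that by (intro sum.cong arg_cong2[where f="(*)"] refl C) auto
      finally show ?thesis .
    qed
    show ?thesis
      unfolding * Q_def by (simp add: sum_distrib_left sum_negf mult_ac)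
  qed
  have quad': "(\<Sum>c=1..n. J r c * (\<Sum>d=1..n. J p d * (\<Sum>b=1..n. J q b * (\<Sum>e=1..n. C a d e * C e c b))))
      = - Q r p q" if "r \<in> {1..n}" "p \<in> {1..n}" "q \<in> {1..n}" for r p q
  proof -
    have "(\<Sum>c=1..n. J r c * (\<Sum>d=1..n. J p d * (\<Sum>b=1..n. J q b * (\<Sum>e=1..n. C a d e * C e c b))))
       = (\<Sum>d=1..n. J p d * (\<Sum>c=1..n. J r c * (\<Sum>b=1..n. J q b * (\<Sum>e=1..n. C a d e * C e c b))))"
      unfolding sum_distrib_left by (subst sum.swap) (simp add: mult_ac)
    then show ?thesis using quad that by simp
  qed
  have zero: "(\<Sum>c=1..n. J r c * (\<Sum>d=1..n. J p d * (\<Sum>b=1..n. J q b * R c d b))) = 0"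
    if "r \<in> {1..n}" "p \<in> {1..n}" "q \<in> {1..n}" for r p q
  proof -
    have "(\<Sum>c=1..n. J r c * (\<Sum>d=1..n. J p d * (\<Sum>b=1..n. J q b * R c d b)))
       = X r p q - X p r q - Q p r q + Q r p q"
      unfolding R_def ring_distribs sum.distrib sum_subtractf X_def[symmetric] X_swap
        quad[OF that] quad'[OF that] by simp
    moreover have "S r p q = S p r q"
      unfolding S_def by (simp add: H[of r p])
    ultimately show ?thesis
      using X[OF that] X[OF that(2,1,3)] T[of r p q a] by simp
  qed
  \<comment> \<open>Invertibility of \<open>J\<close> removes the three contractions from
    \<open>zero\<close> one after another.\<close>
  have J_inj: "f c = 0" if "\<And>r. r \<in> {1..n} \<Longrightarrow> (\<Sum>c=1..n. J r c * f c) = 0" "c \<in> {1..n}" for f c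
    using left_inverse_cancel[OF K that(2), of f] that(1) by simp
  have "R c d b = 0"
    by (rule J_inj[of "R c d" b], rule J_inj[of "\<lambda>d. \<Sum>b=1..n. J _ b * R c d b" d],
        rule J_inj[of "\<lambda>c. \<Sum>d=1..n. J _ d * (\<Sum>b=1..n. J _ b * R c d b)" c])
      (use idx zero in auto)
  then show ?thesis unfolding R_def .
qed

section \<open>Bilinearity and gradients of \<open>bform\<close> on coordinate sequences\<close>

definition kron :: "nat \<Rightarrow> nat \<Rightarrow> complex" where
  "kron s k = (if s = k then 1 else 0)"

text \<open>The basic invariants as an infinite sequence, with \<open>u\<^sub>0 = 1\<close> and \<open>u\<^sub>k = 0\<close> for \<open>k > n\<close>.\<close>
definition coord :: "nat \<Rightarrow> (nat \<Rightarrow> complex) \<Rightarrow> nat \<Rightarrow> complex" where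
  "coord n u k = (if k = 0 then 1 else if k \<le> n then u k else 0)"

lemma bform_add_left:
  "bform n i j (\<lambda>k. e k + c * f k) d = bform n i j e d + c * bform n i j f d"
  unfolding bform_def
  by (simp add: algebra_simps sum_distrib_left) (simp add: sum.distrib[symmetric] algebra_simps)

lemma bform_add_right:
  "bform n i j e (\<lambda>k. d k + c * f k) = bform n i j e d + c * bform n i j e f"
  unfolding bform_swap[of n i j e] by (rule bform_add_left)

lemma bform_sum_right:
  assumes "finite S"
  shows "bform n i j e (\<lambda>k. \<Sum>s\<in>S. c s * f s k) = (\<Sum>s\<in>S. c s * bform n i j e (f s))"
  using assms
proof (induction S rule: finite_induct)
  case empty
  then show ?case by (simp add: bform_def)
next
  case (insert s S)
  then show ?case
    using bform_add_right[of n i j e "\<lambda>k. \<Sum>s\<in>S. c s * f s k" "c s" "f s"] by (simp add: add.commute)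
qed

text \<open>Such a \<open>d\<close> is a combination of the sequences \<open>kron s\<close>. This
  turns chain-rule sums into single values of \<open>bform\<close>.\<close>

lemma bform_expand_right:
  assumes "d 0 = 0" "\<And>k. k > n \<Longrightarrow> d k = 0"
  shows "bform n i j e d = (\<Sum>s=1..n. d s * bform n i j e (kron s))"
proof -
  have "d = (\<lambda>k. \<Sum>s=1..n. d s * kron s k)"
  proof
    fix k
    show "d k = (\<Sum>s=1..n. d s * kron s k)"
    proof (cases "k \<in> {1..n}")
      case True
      then show ?thesis by (simp only: kron_def sum_delta_right)
    next
      case False
      then have "d k = 0" using assms by (cases "k = 0") auto
      moreover have "(\<Sum>s=1..n. d s * kron s k) = 0"
        using False by (intro sum.neutral) (auto simp: kron_def)
      ultimately show ?thesis by simp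
    qed
  qed
  then have "bform n i j e d = bform n i j e (\<lambda>k. \<Sum>s=1..n. d s * kron s k)"
    by (rule arg_cong)
  then show ?thesis by (simp only: bform_sum_right finite_atLeastAtMost)
qed

lemma DERIV_bform:
  assumes e: "\<And>k. ((\<lambda>t. e t k) has_field_derivative e' k) (at s)"
    and d: "\<And>k. ((\<lambda>t. d t k) has_field_derivative d' k) (at s)"
  shows "((\<lambda>t. bform n i j (e t) (d t)) has_field_derivative
    bform n i j e' (d s) + bform n i j (e s) d') (at s)"
proof -
  have mult: "((\<lambda>t. c * e t k * d t l) has_field_derivative c * e' k * d s l + c * e s k * d' l) (at s)" for c k l
    by (rule derivative_eq_intros e d refl)+ (simp add: algebra_simps)
  have "((\<lambda>t. bform n i j (e t) (d t)) has_field_derivative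
     ((of_nat n - of_nat i - 1) * (of_nat n - of_nat j) * e' i * d s j
       + (of_nat n - of_nat i - 1) * (of_nat n - of_nat j) * e s i * d' j)
     + (\<Sum>m=1..i. ((of_nat m + of_nat j - of_nat i) * e' (i - m) * d s (j + m)
          + (of_nat m + of_nat j - of_nat i) * e s (i - m) * d' (j + m))
         + (of_nat m * e' (j + m) * d s (i - m) + of_nat m * e s (j + m) * d' (i - m)))) (at s)"
    unfolding bform_def by (intro DERIV_add DERIV_sum mult)
  then show ?thesis
    by (rule DERIV_cong) (simp add: bform_def algebra_simps, simp add: sum.distrib[symmetric] algebra_simps)
qed

lemma DERIV_coord:
  assumes "\<And>k. k \<in> {1..n} \<Longrightarrow> ((\<lambda>s. w s k) has_field_derivative w' k) (at t)"
  shows "((\<lambda>s. coord n (w s) k) has_field_derivative (if k \<in> {1..n} then w' k else 0)) (at t)"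
  using assms[of k] by (cases "k \<in> {1..n}") (auto simp: coord_def)

text \<open>By linearity: \<open>kron s\<close> is the derivative of \<open>coord n v\<close> in
  \<open>v s\<close>, the entries at 0 and beyond \<open>n\<close> being constant.\<close>

lemma has_gradient_bform_right:
  "has_gradient n (\<lambda>v. bform n i j e (coord n v)) (\<lambda>s. bform n i j e (kron s)) u"
  unfolding has_gradient_def
proof (intro allI impI)
  fix w w' t
  assume w: "w t = u" "\<forall>k\<in>{1..n}. ((\<lambda>s. w s k) has_field_derivative w' k) (at t)"
  have "((\<lambda>s. bform n i j e (coord n (w s))) has_field_derivative
      bform n i j (\<lambda>_. 0) (coord n (w t)) + bform n i j e (\<lambda>k. if k \<in> {1..n} then w' k else 0)) (at t)"
    using w by (intro DERIV_bform DERIV_coord DERIV_const) auto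
  also have "bform n i j (\<lambda>_. 0) (coord n (w t)) = 0" by (simp add: bform_def)
  also have "bform n i j e (\<lambda>k. if k \<in> {1..n} then w' k else 0)
      = (\<Sum>s=1..n. bform n i j e (kron s) * w' s)"
    by (subst bform_expand_right) (auto intro!: sum.cong)
  finally show "((\<lambda>s. bform n i j e (coord n (w s))) has_field_derivative
      (\<Sum>s=1..n. bform n i j e (kron s) * w' s)) (at t)" by simp
qed

lemma has_gradient_bform_left:
  "has_gradient n (\<lambda>v. bform n i j (coord n v) e) (\<lambda>s. bform n i j (kron s) e) u"
  using has_gradient_bform_right[of n j i e u] by (simp add: bform_swap[of n j i])

lemma has_gradient_bform_diag:
  "has_gradient n (\<lambda>v. bform n i j (coord n v) (coord n v))
    (\<lambda>s. bform n i j (coord n u) (kron s) + bform n i j (kron s) (coord n u)) u"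
  unfolding has_gradient_def
proof (intro allI impI)
  fix w w' t
  assume w: "w t = u" "\<forall>k\<in>{1..n}. ((\<lambda>s. w s k) has_field_derivative w' k) (at t)"
  let ?d = "\<lambda>k. if k \<in> {1..n} then w' k else 0"
  have "((\<lambda>s. bform n i j (coord n (w s)) (coord n (w s))) has_field_derivative
      bform n i j ?d (coord n (w t)) + bform n i j (coord n (w t)) ?d) (at t)"
    using w by (intro DERIV_bform DERIV_coord) auto
  also have "bform n i j ?d (coord n (w t)) = (\<Sum>s=1..n. bform n i j (kron s) (coord n u) * w' s)"
    unfolding bform_swap[of n i j _ "coord n (w t)"]
    by (subst bform_expand_right) (auto intro!: sum.cong simp: w bform_swap[of n j i])
  also have "bform n i j (coord n (w t)) ?d = (\<Sum>s=1..n. bform n i j (coord n u) (kron s) * w' s)"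
    by (subst bform_expand_right) (auto intro!: sum.cong simp: w)
  finally show "((\<lambda>s. bform n i j (coord n (w s)) (coord n (w s))) has_field_derivative
      (\<Sum>s=1..n. (bform n i j (coord n u) (kron s) + bform n i j (kron s) (coord n u)) * w' s)) (at t)"
    by (simp add: sum.distrib distrib_right add.commute)
qed

section \<open>The metric in the invariants, its connection and its flatness\<close>

definition gmet :: "nat \<Rightarrow> cmetric" where
  "gmet n i j u = (if i \<in> {1..n} \<and> j \<in> {1..n}
     then 4 * bform n (i - 1) (j - 1) (coord n u) (coord n u) else 0)"

text \<open>The contravariant Christoffel symbols of \<open>gmet\<close>, as
  \<open>cchr_gmet\<close> confirms; affine in \<open>u\<close>, which enters one argument of the
  form only.\<close>

definition gam :: "nat \<Rightarrow> nat \<Rightarrow> nat \<Rightarrow> nat \<Rightarrow> (nat \<Rightarrow> complex) \<Rightarrow> complex" where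
  "gam n i j k u = 4 * bform n (i - 1) (j - 1) (coord n u) (kron k)"

lemma gmet_commute: "gmet n i j = gmet n j i"
  by (rule ext) (auto simp: gmet_def bform_swap[of n "i - 1"])

lemma has_gradient_cmult:
  "has_gradient n f f' u \<Longrightarrow> has_gradient n (\<lambda>v. c * f v) (\<lambda>k. c * f' k) u"
  using has_gradient_mult[OF has_gradient_const[of n c u]] by (simp add: mult.commute)

lemma has_gradient_gmet:
  assumes "i \<in> {1..n}" "j \<in> {1..n}"
  shows "has_gradient n (gmet n i j) (\<lambda>s. gam n i j s u + gam n j i s u) u"
proof -
  have "gmet n i j = (\<lambda>v. 4 * bform n (i - 1) (j - 1) (coord n v) (coord n v))"
    using assms by (auto simp: gmet_def)
  moreover have "gam n i j s u + gam n j i s u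
      = 4 * (bform n (i - 1) (j - 1) (coord n u) (kron s) + bform n (i - 1) (j - 1) (kron s) (coord n u))" for s
    unfolding gam_def bform_swap[of n "j - 1" "i - 1"] by simp
  ultimately show ?thesis
    by (simp only: has_gradient_cmult[OF has_gradient_bform_diag])
qed

lemma has_gradient_gam:
  "has_gradient n (gam n i j k) (\<lambda>s. 4 * bform n (i - 1) (j - 1) (kron s) (kron k)) u"
  unfolding gam_def[abs_def] by (intro has_gradient_cmult has_gradient_bform_left)

text \<open>The entries of \<open>coord n u\<close> are the coefficients of a polynomial of degree
  at most \<open>n\<close> with constant term 1, which \<open>linpoly_surj\<close> factors.\<close>

lemma coord_eq_esym: "\<exists>x. coord n u = (\<lambda>k. esym n k x)"
proof -
  define q where "q = (\<Sum>k\<le>n. monom (coord n u k) k)"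
  have q: "coeff q k = coord n u k" for k
    by (simp add: q_def coeff_sum coord_def)
  have "degree q \<le> n"
    by (rule degree_le) (auto simp: q coord_def)
  then obtain x where "q = linpoly {1..n} x"
    using linpoly_surj[of q n] by (auto simp: q coord_def)
  then have "coord n u = (\<lambda>k. esym n k x)"
    unfolding esym_def by (auto simp: q[symmetric])
  then show ?thesis by blast
qed

text \<open>The derivative of \<open>u\<^sub>i\<close> in the direction \<open>b\<close> raised by the constant matrix \<open>4 (1 - \<delta>)\<close>.\<close>
definition frame :: "nat \<Rightarrow> nat \<Rightarrow> nat \<Rightarrow> (nat \<Rightarrow> complex) \<Rightarrow> complex" where
  "frame n b i x = 4 * ((\<Sum>a=1..n. esym1 n a i x) - esym1 n b i x)"

lemma gmet_frame:
  assumes "coord n u = (\<lambda>k. esym n k x)" "i \<in> {1..n}" "j \<in> {1..n}"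
  shows "gmet n i j u = (\<Sum>b=1..n. frame n b i x * esym1 n b j x)"
proof -
  obtain i' j' where ij: "i = Suc i'" "j = Suc j'"
    using assms(2,3) by (cases i; cases j) auto
  have "gmet n i j u = 4 * ((\<Sum>a=1..n. esym1 n a i x) * (\<Sum>a=1..n. esym1 n a j x)
      - (\<Sum>b=1..n. esym1 n b i x * esym1 n b j x))"
    using assms by (simp add: gmet_def bform_esym ij sum_esym1)
  also have "\<dots> = (\<Sum>b=1..n. frame n b i x * esym1 n b j x)"
    unfolding frame_def
    by (simp add: algebra_simps sum_subtractf sum_distrib_left)
  finally show ?thesis .
qed

text \<open>As a sequence, \<open>esym1 n a\<close> vanishes at 0 and beyond \<open>n\<close>, so
  \<open>bform_expand_right\<close> collapses the contraction to the value found in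
  \<open>bform_esym1\<close>.\<close>

lemma gam_frame:
  assumes "coord n u = (\<lambda>k. esym n k x)" "i \<in> {1..n}" "j \<in> {1..n}" "a \<in> {1..n}"
  shows "(\<Sum>s=1..n. gam n i j s u * esym1 n a s x) = (\<Sum>b=1..n. frame n b i x * esym2 n a b j x)"
proof -
  obtain i' j' where ij: "i = Suc i'" "j = Suc j'"
    using assms(2,3) by (cases i; cases j) auto
  have "(\<Sum>s=1..n. gam n i j s u * esym1 n a s x)
      = 4 * bform n i' j' (\<lambda>k. esym n k x) (\<lambda>k. esym1 n a k x)"
    using assms(4)
    by (subst bform_expand_right)
       (auto simp: esym1_0 esym1_gt gam_def assms(1) ij sum_distrib_left mult_ac)
  also have "\<dots> = 4 * ((\<Sum>b=1..n. esym1 n b i x) * (\<Sum>b=1..n. esym2 n a b j x)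
      - (\<Sum>b=1..n. esym1 n b i x * esym2 n a b j x))"
    unfolding bform_esym1[OF assms(4)] ij sum_esym1 sum_esym2[OF assms(4)] by simp
  also have "\<dots> = (\<Sum>b=1..n. frame n b i x * esym2 n a b j x)"
    unfolding frame_def
    by (simp add: algebra_simps sum_subtractf sum_distrib_left)
  finally show ?thesis .
qed

text \<open>Over a preimage \<open>x\<close> both sides become double sums of \<open>frame\<close>
  factors against \<open>esym2\<close>, and mixed partial derivatives commute.\<close>

lemma gam_torsion_free:
  assumes "i \<in> {1..n}" "j \<in> {1..n}" "k \<in> {1..n}"
  shows "(\<Sum>s=1..n. gmet n i s u * gam n j k s u) = (\<Sum>s=1..n. gmet n j s u * gam n i k s u)"
proof -
  obtain x where x: "coord n u = (\<lambda>k. esym n k x)" using coord_eq_esym by blast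
  have *: "(\<Sum>s=1..n. gmet n i s u * gam n j k s u)
      = (\<Sum>b=1..n. \<Sum>a=1..n. frame n b i x * frame n a j x * esym2 n b a k x)"
    if "i \<in> {1..n}" "j \<in> {1..n}" for i j
  proof -
    have "(\<Sum>s=1..n. gmet n i s u * gam n j k s u)
        = (\<Sum>s=1..n. \<Sum>b=1..n. frame n b i x * (gam n j k s u * esym1 n b s x))"
      using that
      by (intro sum.cong) (auto simp: gmet_frame[OF x] sum_distrib_left sum_distrib_right mult_ac)
    also have "\<dots> = (\<Sum>b=1..n. frame n b i x * (\<Sum>s=1..n. gam n j k s u * esym1 n b s x))"
      unfolding sum_distrib_left by (rule sum.swap)
    also have "\<dots> = (\<Sum>b=1..n. frame n b i x * (\<Sum>a=1..n. frame n a j x * esym2 n b a k x))"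
      using that assms by (intro sum.cong arg_cong2[where f="(*)"] refl gam_frame[OF x]) auto
    finally show ?thesis by (simp add: sum_distrib_left mult_ac)
  qed
  have "(\<Sum>b=1..n. \<Sum>a=1..n. frame n b i x * frame n a j x * esym2 n b a k x)
      = (\<Sum>b=1..n. \<Sum>a=1..n. frame n b j x * frame n a i x * esym2 n b a k x)"
    by (subst sum.swap) (simp add: esym2_commute[of n _ _ k] mult_ac)
  then show ?thesis using assms by (simp only: *)
qed

text \<open>\<open>has_gradient_gmet\<close> already has the shape that metric compatibility asks
  for, so \<open>refl\<close> discharges that premise.\<close>

lemma chr_gmet:
  assumes "nondeg n (gmet n) u" "j \<in> {1..n}" "s \<in> {1..n}" "k \<in> {1..n}"
  shows "chr n (gmet n) j s k u = - (\<Sum>i=1..n. cov n (gmet n) u s i * gam n i j k u)"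
  by (rule chr_unique[OF has_gradient_gmet _ left_inverse_cov[OF assms(1)] refl gam_torsion_free])
    (use assms gmet_commute in auto)

lemma cchr_gmet:
  assumes "nondeg n (gmet n) u" "i \<in> {1..n}" "j \<in> {1..n}" "k \<in> {1..n}"
  shows "cchr n (gmet n) i j k u = gam n i j k u"
  by (rule cchr_unique[OF has_gradient_gmet _ left_inverse_cov[OF assms(1)] refl gam_torsion_free])
    (use assms gmet_commute in auto)

text \<open>By \<open>gmet_frame\<close> the metric factors through the Jacobian
  \<open>esym1\<close>, so its nondegeneracy makes the Jacobian invertible.\<close>

lemma left_inverse_jacobian:
  assumes x: "coord n u = (\<lambda>k. esym n k x)" and h: "left_inverse n h (\<lambda>i j. gmet n i j u)"
  shows "left_inverse n (\<lambda>i b. \<Sum>s=1..n. h i s * frame n b s x) (\<lambda>b s. esym1 n b s x)"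
  unfolding left_inverse_def
proof (intro ballI)
  fix i j assume ij: "i \<in> {1..n}" "j \<in> {1..n}"
  have "(\<Sum>b=1..n. (\<Sum>s=1..n. h i s * frame n b s x) * esym1 n b j x)
      = (\<Sum>s=1..n. h i s * (\<Sum>b=1..n. frame n b s x * esym1 n b j x))"
    unfolding sum_distrib_left sum_distrib_right by (subst sum.swap) (simp add: mult.assoc)
  also have "\<dots> = (\<Sum>s=1..n. h i s * gmet n s j u)"
    using ij by (intro sum.cong) (simp_all add: gmet_frame[OF x])
  finally show "(\<Sum>b=1..n. (\<Sum>s=1..n. h i s * frame n b s x) * esym1 n b j x) = (if i = j then 1 else 0)"
    using left_inverseD[OF h ij] by simp
qed

text \<open>The transformation law of a connection that vanishes in the coordinates
  \<open>x\<close>: after \<open>chr_gmet\<close> and \<open>gam_frame\<close>, the Jacobian cancels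
  against its inverse.\<close>

lemma chr_gmet_pullback:
  assumes nd: "nondeg n (gmet n) u" and x: "coord n u = (\<lambda>k. esym n k x)"
    and idx: "a \<in> {1..n}" "p \<in> {1..n}" "q \<in> {1..n}"
  shows "(\<Sum>d=1..n. \<Sum>b=1..n. chr n (gmet n) a d b u * esym1 n p d x * esym1 n q b x) = - esym2 n p q a x"
proof -
  let ?h = "cov n (gmet n) u"
  have "(\<Sum>b=1..n. chr n (gmet n) a d b u * esym1 n p d x * esym1 n q b x)
      = - (esym1 n p d x * (\<Sum>c=1..n. (\<Sum>i=1..n. ?h d i * frame n c i x) * esym2 n q c a x))"
    if d: "d \<in> {1..n}" for d
  proof -
    have "(\<Sum>b=1..n. chr n (gmet n) a d b u * esym1 n p d x * esym1 n q b x)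
        = (\<Sum>b=1..n. - (esym1 n p d x * (\<Sum>i=1..n. ?h d i * (gam n i a b u * esym1 n q b x))))"
      using d idx by (intro sum.cong) (auto simp: chr_gmet[OF nd] sum_distrib_left sum_distrib_right mult_ac)
    also have "\<dots> = - (esym1 n p d x * (\<Sum>i=1..n. ?h d i * (\<Sum>b=1..n. gam n i a b u * esym1 n q b x)))"
      unfolding sum_negf sum_distrib_left by (subst sum.swap) simp
    also have "(\<Sum>i=1..n. ?h d i * (\<Sum>b=1..n. gam n i a b u * esym1 n q b x))
        = (\<Sum>i=1..n. ?h d i * (\<Sum>c=1..n. frame n c i x * esym2 n q c a x))"
      using idx by (intro sum.cong arg_cong2[where f="(*)"] refl gam_frame[OF x]) auto
    also have "\<dots> = (\<Sum>c=1..n. (\<Sum>i=1..n. ?h d i * frame n c i x) * esym2 n q c a x)"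
      unfolding sum_distrib_left sum_distrib_right by (subst sum.swap) (simp add: mult.assoc)
    finally show ?thesis .
  qed
  then have "(\<Sum>d=1..n. \<Sum>b=1..n. chr n (gmet n) a d b u * esym1 n p d x * esym1 n q b x)
     = - (\<Sum>d=1..n. esym1 n p d x * (\<Sum>c=1..n. (\<Sum>i=1..n. ?h d i * frame n c i x) * esym2 n q c a x))"
    by (simp add: sum_negf)
  also have "\<dots> = - esym2 n q p a x"
    using left_inverse_cancel[OF left_inverse_commute[OF left_inverse_jacobian[OF x left_inverse_cov[OF nd]]] idx(2)]
    by simp
  finally show ?thesis by (simp add: esym2_commute[of n q])
qed

text \<open>\<open>chr_gmet_pullback\<close> and its derivative in \<open>x r\<close> supply the two
  premises on the connection in \<open>curvature_pullback_zero\<close>.\<close>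

lemma flat_gmet: "flat n (gmet n)"
  unfolding flat_def
proof (intro allI impI ballI)
  fix u a b c d
  assume nd: "nondeg n (gmet n) u"
    and idx: "a \<in> {1..n}" "b \<in> {1..n}" "c \<in> {1..n}" "d \<in> {1..n}"
  obtain x where x: "coord n u = (\<lambda>k. esym n k x)" using coord_eq_esym by blast
  let ?C = "chr n (gmet n)"
  have grad: "has_gradient n (?C a d b) (\<lambda>m. pd (?C a d b) m u) u"
    if "a \<in> {1..n}" "d \<in> {1..n}" "b \<in> {1..n}" for a d b
    by (rule has_gradient_chr[OF has_gradient_gmet nd has_gradient_gam chr_gmet]) (use that in auto)
  have deriv: "(\<Sum>d=1..n. \<Sum>b=1..n. (\<Sum>c=1..n. pd (?C a d b) c u * esym1 n r c x) * esym1 n p d x * esym1 n q b x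
         + ?C a d b u * esym2 n r p d x * esym1 n q b x + ?C a d b u * esym1 n p d x * esym2 n r q b x)
      = - esym3 n r p q a x"
    if "a \<in> {1..n}" "r \<in> {1..n}" "p \<in> {1..n}" "q \<in> {1..n}" for a r p q
  proof (rule DERIV_unique)
    \<comment> \<open>The image in the orbit space of the line through \<open>x\<close> in direction
      \<open>r\<close>. Keeping \<open>u\<close> outside \<open>{1..n}\<close> makes
      \<open>w (x r)\<close> equal to \<open>u\<close> as a function.\<close>
    define w where "w t k = (if k \<in> {1..n} then esym n k (x(r := t)) else u k)" for t k
    have cw: "coord n (w t) = (\<lambda>k. esym n k (x(r := t)))" for t
      by (rule ext) (auto simp: coord_def w_def esym_0 esym_gt)
    have w0: "w (x r) = u"
    proof
      fix k show "w (x r) k = u k"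
        using fun_cong[OF x, of k] by (auto simp: w_def coord_def)
    qed
    have w': "((\<lambda>t. w t k) has_field_derivative esym1 n r k x) (at (x r))" if "k \<in> {1..n}" for k
      using deriv_esym[OF \<open>r \<in> _\<close>, of k x "x r"] that by (simp add: w_def)
    have dC: "((\<lambda>t. ?C a d b (w t)) has_field_derivative (\<Sum>c=1..n. pd (?C a d b) c u * esym1 n r c x)) (at (x r))"
      if "d \<in> {1..n}" "b \<in> {1..n}" for d b
      by (rule has_gradientD) (use grad \<open>a \<in> _\<close> that w' w0 in auto)
    let ?F = "\<lambda>t. \<Sum>d=1..n. \<Sum>b=1..n. ?C a d b (w t) * esym1 n p d (x(r := t)) * esym1 n q b (x(r := t))"
    have "(?F has_field_derivative (\<Sum>d=1..n. \<Sum>b=1..n.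
         ((\<Sum>c=1..n. pd (?C a d b) c u * esym1 n r c x) * esym1 n p d (x(r := x r))
            + esym2 n r p d x * ?C a d b (w (x r))) * esym1 n q b (x(r := x r))
         + esym2 n r q b x * (?C a d b (w (x r)) * esym1 n p d (x(r := x r))))) (at (x r))"
      by (intro DERIV_sum DERIV_mult dC deriv_esym1 \<open>r \<in> _\<close>)
    then show "(?F has_field_derivative (\<Sum>d=1..n. \<Sum>b=1..n.
         (\<Sum>c=1..n. pd (?C a d b) c u * esym1 n r c x) * esym1 n p d x * esym1 n q b x
         + ?C a d b u * esym2 n r p d x * esym1 n q b x + ?C a d b u * esym1 n p d x * esym2 n r q b x)) (at (x r))"
      by (rule DERIV_cong) (intro sum.cong refl, simp add: w0 algebra_simps)
    have "((\<lambda>t. - esym2 n p q a (x(r := t))) has_field_derivative - esym3 n r p q a x) (at (x r))"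
      by (intro DERIV_minus deriv_esym2 that)
    \<comment> \<open>The pullback identity is available at nondegenerate points, hence for
      \<open>t\<close> near \<open>x r\<close>.\<close>
    moreover have "eventually (\<lambda>t. - esym2 n p q a (x(r := t)) = ?F t) (nhds (x r))"
    proof -
      have "eventually (\<lambda>t. nondeg n (gmet n) (w t)) (nhds (x r))"
        by (rule eventually_nondeg[OF has_gradient_gmet left_inverse_cov[OF nd], of w "x r"]) (use w0 w' in auto)
      then show ?thesis
        by eventually_elim (use chr_gmet_pullback cw that in simp)
    qed
    ultimately show "(?F has_field_derivative - esym3 n r p q a x) (at (x r))"
      by (rule has_field_derivative_cong_nhds)
  qed
  show "riem n (gmet n) a b c d u = 0"
    unfolding riem_def
    by (rule curvature_pullback_zero[where C="\<lambda>a d b. ?C a d b u" and C'="\<lambda>a d b c. pd (?C a d b) c u"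
        and J="\<lambda>p k. esym1 n p k x" and H="\<lambda>p q a. esym2 n p q a x" and T="\<lambda>r p q a. esym3 n r p q a x",
        OF left_inverse_jacobian[OF x left_inverse_cov[OF nd]] chr_gmet_pullback[OF nd x] deriv
          esym2_commute esym3_commute idx])
qed

section \<open>The pencil as a translation\<close>

definition shift :: "nat \<Rightarrow> complex \<Rightarrow> (nat \<Rightarrow> complex) \<Rightarrow> nat \<Rightarrow> complex" where
  "shift m c u = u(m := u m + c)"

lemma deriv_shift: "deriv (\<lambda>t. f (t + c)) z = deriv f (z + c)" for f :: "complex \<Rightarrow> complex"
  unfolding deriv_def by (simp only: DERIV_shift[of f _ z c])

lemma pd_shift: "pd (\<lambda>v. f (shift m c v)) k u = pd f k (shift m c u)"
proof (cases "k = m")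
  case True
  have "(\<lambda>t. f (shift m c (u(m := t)))) = (\<lambda>t. f ((shift m c u)(m := t + c)))"
    by (simp add: shift_def)
  then show ?thesis
    unfolding pd_def True
    using deriv_shift[of "\<lambda>t. f ((shift m c u)(m := t))" c "u m"] by (simp add: shift_def)
next
  case False
  then show ?thesis unfolding pd_def by (simp add: shift_def fun_upd_twist)
qed

lemma nondeg_shift: "nondeg n (\<lambda>i j u. G i j (shift m c u)) u \<longleftrightarrow> nondeg n G (shift m c u)"
  unfolding nondeg_def ..

lemma cov_shift: "cov n (\<lambda>i j u. G i j (shift m c u)) u = cov n G (shift m c u)"
  unfolding cov_def ..

lemma chr_shift: "chr n (\<lambda>i j u. G i j (shift m c u)) j s k u = chr n G j s k (shift m c u)"
  unfolding chr_def cov_shift pd_shift[of "\<lambda>v. cov n G v _ _"] ..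

lemma cchr_shift: "cchr n (\<lambda>i j u. G i j (shift m c u)) i j k u = cchr n G i j k (shift m c u)"
  unfolding cchr_def chr_shift ..

lemma flat_shift: "flat n G \<Longrightarrow> flat n (\<lambda>i j u. G i j (shift m c u))"
  unfolding flat_def nondeg_shift riem_def chr_shift pd_shift[of "chr n G _ _ _"] by blast

lemma coord_shift:
  assumes "m \<in> {1..n}"
  shows "coord n (shift m c u) = (\<lambda>k. coord n u k + c * kron m k)"
  using assms by (auto simp: coord_def shift_def kron_def)

text \<open>The leading term needs \<open>i = n - 1\<close>, where its factor
  \<open>n - i - 1\<close> vanishes, and in the sum \<open>i - m\<close> stays below
  \<open>n - 1\<close>. This makes \<open>gmet\<close> affine in the coordinate
  \<open>n - 1\<close>.\<close>

lemma bform_kron_top: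
  assumes "i < n" "j < n"
  shows "bform n i j (kron (n - 1)) (kron (n - 1)) = 0"
proof -
  have "(of_nat n - of_nat i - 1 :: complex) * kron (n - 1) i = 0"
    using assms by (auto simp: kron_def of_nat_diff One_nat_def)
  moreover have "(\<Sum>m=1..i. (of_nat m + of_nat j - of_nat i) * kron (n - 1) (i - m) * kron (n - 1) (j + m)
                 + of_nat m * kron (n - 1) (j + m) * kron (n - 1) (i - m)) = 0"
    using assms by (intro sum.neutral) (auto simp: kron_def)
  ultimately show ?thesis unfolding bform_def by auto
qed

definition geta :: "nat \<Rightarrow> cmetric" where
  "geta n i j u = pd (gmet n i j) (n - 1) u"

text \<open>The derivative of \<open>gam\<close> in the coordinate \<open>n - 1\<close>, independent
  of \<open>u\<close> because \<open>gam\<close> is affine.\<close>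

definition eta_gam :: "nat \<Rightarrow> nat \<Rightarrow> nat \<Rightarrow> nat \<Rightarrow> complex" where
  "eta_gam n i j k = 4 * bform n (i - 1) (j - 1) (kron (n - 1)) (kron k)"

lemma geta_eq:
  assumes "n \<ge> 2" "i \<in> {1..n}" "j \<in> {1..n}"
  shows "geta n i j u = 4 * (bform n (i - 1) (j - 1) (coord n u) (kron (n - 1))
    + bform n (i - 1) (j - 1) (kron (n - 1)) (coord n u))"
proof -
  have "geta n i j u = gam n i j (n - 1) u + gam n j i (n - 1) u"
    unfolding geta_def by (rule pd_eq_gradient[OF has_gradient_gmet]) (use assms in auto)
  then show ?thesis unfolding gam_def bform_swap[of n "j - 1" "i - 1"] by simp
qed

lemma geta_outside: "\<not> (i \<in> {1..n} \<and> j \<in> {1..n}) \<Longrightarrow> geta n i j u = 0"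
  unfolding geta_def pd_def gmet_def by (simp only: if_False deriv_const)

text \<open>The expansion in \<open>c\<close> stops at the linear term because its quadratic
  coefficient vanishes by \<open>bform_kron_top\<close>.\<close>

lemma gmet_shift:
  assumes "n \<ge> 2"
  shows "gmet n i j (shift (n - 1) c u) = gmet n i j u + c * geta n i j u"
proof (cases "i \<in> {1..n} \<and> j \<in> {1..n}")
  case True
  have "n - 1 \<in> {1..n}" using assms by auto
  moreover have "bform n (i - 1) (j - 1) (kron (n - 1)) (kron (n - 1)) = 0"
    using True by (intro bform_kron_top) auto
  ultimately show ?thesis
    using True by (simp add: gmet_def geta_eq assms coord_shift bform_add_left bform_add_right algebra_simps)
next
  case False
  \<comment> \<open>Both metrics are 0 outside the index range, so \<open>pencil_eq_shift\<close>
    can be an equality of functions.\<close>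
  then show ?thesis by (auto simp: gmet_def geta_outside)
qed

lemma pencil_eq_shift:
  "n \<ge> 2 \<Longrightarrow> pencil (gmet n) (geta n) c = (\<lambda>i j u. gmet n i j (shift (n - 1) c u))"
  by (simp add: pencil_def gmet_shift)

lemma gam_shift:
  assumes "n \<ge> 2"
  shows "gam n i j k (shift (n - 1) c u) = gam n i j k u + c * eta_gam n i j k"
proof -
  have "n - 1 \<in> {1..n}" using assms by auto
  then show ?thesis by (simp add: gam_def eta_gam_def coord_shift bform_add_left algebra_simps)
qed

lemma has_gradient_geta:
  assumes "n \<ge> 2" "i \<in> {1..n}" "j \<in> {1..n}"
  shows "has_gradient n (geta n i j) (\<lambda>s. eta_gam n i j s + eta_gam n j i s) u"
proof -
  have "geta n i j = (\<lambda>v. 4 * (bform n (i - 1) (j - 1) (coord n v) (kron (n - 1))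
      + bform n (i - 1) (j - 1) (kron (n - 1)) (coord n v)))"
    using assms by (intro ext geta_eq)
  moreover have "eta_gam n i j s + eta_gam n j i s = 4 * (bform n (i - 1) (j - 1) (kron s) (kron (n - 1))
      + bform n (i - 1) (j - 1) (kron (n - 1)) (kron s))" for s
    unfolding eta_gam_def bform_swap[of n "j - 1" "i - 1"] by simp
  ultimately show ?thesis
    by (simp only: has_gradient_cmult[OF has_gradient_add[OF has_gradient_bform_left has_gradient_bform_right]])
qed

text \<open>The torsion identity of the shifted metric is a quadratic polynomial in the shift parameter;
  its leading coefficient is the torsion identity of the second metric.\<close>
lemma eta_gam_torsion_free:
  assumes n: "n \<ge> 2" and ijk: "i \<in> {1..n}" "j \<in> {1..n}" "k \<in> {1..n}"
  shows "(\<Sum>s=1..n. geta n i s u * eta_gam n j k s) = (\<Sum>s=1..n. geta n j s u * eta_gam n i k s)"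
proof -
  define A B C where
    "A i j = (\<Sum>s=1..n. gmet n i s u * gam n j k s u)" and
    "B i j = (\<Sum>s=1..n. gmet n i s u * eta_gam n j k s + geta n i s u * gam n j k s u)" and
    "C i j = (\<Sum>s=1..n. geta n i s u * eta_gam n j k s)" for i j
  define F where "F c i j = (\<Sum>s=1..n. gmet n i s (shift (n - 1) c u) * gam n j k s (shift (n - 1) c u))" for c i j
  have F: "F c i j = A i j + c * B i j + c\<^sup>2 * C i j" for c i j
    unfolding F_def A_def B_def C_def gmet_shift[OF n] gam_shift[OF n] sum_distrib_left sum.distrib[symmetric]
    by (intro sum.cong) (auto simp: algebra_simps power2_eq_square)
  \<comment> \<open>A second difference at the parameters 1, -1 and 0 isolates the quadratic
    coefficient.\<close>
  have "2 * C i j = F 1 i j + F (- 1) i j - 2 * F 0 i j" for i j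
    unfolding F by simp
  moreover have "F c i j = F c j i" for c
    unfolding F_def by (rule gam_torsion_free[OF ijk])
  ultimately have "2 * C i j = 2 * C j i" by simp
  then show ?thesis unfolding C_def by simp
qed

lemma cchr_geta:
  assumes "n \<ge> 2" "nondeg n (geta n) u" "i \<in> {1..n}" "j \<in> {1..n}" "k \<in> {1..n}"
  shows "cchr n (geta n) i j k u = eta_gam n i j k"
  by (rule cchr_unique[OF has_gradient_geta _ left_inverse_cov[OF assms(2)] refl eta_gam_torsion_free])
    (use assms gmet_commute in \<open>auto simp: geta_def\<close>)

section \<open>Nondegeneracy at explicit points, and the flat pencil\<close>

lemma bform_kron_0:
  "bform n i j (kron 0) (kron p) = (if i + j = p
     then if i = 0 then (of_nat n - 1) * (of_nat n - of_nat j) else of_nat j else 0)"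
proof -
  have "(\<Sum>m=1..i. (of_nat m + of_nat j - of_nat i) * kron 0 (i - m) * kron p (j + m)
      + of_nat m * kron 0 (j + m) * kron p (i - m))
      = (\<Sum>m=1..i. (if m = i then (if i + j = p then of_nat j else 0) else 0))"
    by (intro sum.cong) (auto simp: kron_def)
  also have "\<dots> = (if i \<noteq> 0 \<and> i + j = p then of_nat j else 0)"
    by (cases "i = 0") auto
  finally show ?thesis unfolding bform_def by (auto simp: kron_def)
qed

lemma coord_0: "coord n (\<lambda>_. 0) = kron 0"
  by (auto simp: coord_def kron_def)

text \<open>On the antidiagonal the two forms contribute \<open>j - 1\<close> and
  \<open>i - 1\<close>, which add up to \<open>n - 1\<close>.\<close>

lemma geta_0:
  assumes "n \<ge> 2" "i \<in> {1..n}" "j \<in> {1..n}"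
  shows "geta n i j (\<lambda>_. 0) = (if i + j = n + 1 then 4 * (of_nat n - 1) else 0)"
proof -
  obtain i' j' where ij: "i = Suc i'" "j = Suc j'"
    using assms(2,3) by (cases i; cases j) auto
  have "i' + j' = n - 1 \<Longrightarrow> (of_nat i' + of_nat j' :: complex) = of_nat n - 1"
    using assms(1) by (metis of_nat_add of_nat_diff of_nat_1 one_le_numeral order_trans)
  then show ?thesis
    unfolding geta_eq[OF assms] coord_0 bform_swap[of n "i - 1" "j - 1" "kron (n - 1)"] bform_kron_0
    using assms by (auto simp: ij)
qed

lemma gmet_0:
  assumes "i \<in> {1..n}" "j \<in> {1..n}"
  shows "gmet n i j (\<lambda>_. 0) = (if i = 1 \<and> j = 1 then 4 * (of_nat n - 1) * of_nat n else 0)"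
  unfolding gmet_def coord_0 bform_kron_0 using assms by auto

lemma nondeg_geta_0:
  assumes "n \<ge> 2"
  shows "nondeg n (geta n) (\<lambda>_. 0)"
proof -
  have n1: "(of_nat n - 1 :: complex) \<noteq> 0" using assms by auto
  have "left_inverse n (\<lambda>i s. (if n + 1 - i = s then 1 else 0) * (1 / (4 * (of_nat n - 1))))
      (\<lambda>i j. geta n i j (\<lambda>_. 0))"
    unfolding left_inverse_def
  proof (intro ballI)
    fix i j assume ij: "i \<in> {1..n}" "j \<in> {1..n}"
    have "(\<Sum>s=1..n. (if n + 1 - i = s then 1 else 0) * (1 / (4 * (of_nat n - 1))) * geta n s j (\<lambda>_. 0))
        = 1 / (4 * (of_nat n - 1)) * geta n (n + 1 - i) j (\<lambda>_. 0)"
      unfolding mult.assoc by (rule sum_delta_left) (use ij in auto)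
    also have "\<dots> = (if i = j then 1 else 0)"
      using ij n1 by (subst geta_0[OF assms]) auto
    finally show "(\<Sum>s=1..n. (if n + 1 - i = s then 1 else 0) * (1 / (4 * (of_nat n - 1))) * geta n s j (\<lambda>_. 0))
        = (if i = j then 1 else 0)" .
  qed
  then show ?thesis unfolding nondeg_iff by blast
qed

text \<open>At the origin \<open>gmet\<close> has a single nonzero entry, hence is degenerate; one
  unit along the coordinate \<open>n - 1\<close> adds the antidiagonal of
  \<open>geta_0\<close>.\<close>

lemma nondeg_gmet_axis:
  assumes n: "n \<ge> 2"
  shows "nondeg n (gmet n) (shift (n - 1) 1 (\<lambda>_. 0))"
proof -
  let ?u = "shift (n - 1) 1 (\<lambda>_. 0)" and ?k = "4 * (of_nat n - 1) :: complex"
  have n1: "(of_nat n - 1 :: complex) \<noteq> 0" using assms by auto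
  have g: "gmet n i j ?u = ?k * ((if i = 1 \<and> j = 1 then of_nat n else 0) + (if i + j = n + 1 then 1 else 0))"
    if "i \<in> {1..n}" "j \<in> {1..n}" for i j
    unfolding gmet_shift[OF n] gmet_0[OF that] geta_0[OF n that] by simp
  \<comment> \<open>The inverse of the antidiagonal part, corrected at position
    \<open>(n, n)\<close> to cancel the effect of the \<open>(1, 1)\<close> entry of
    \<open>gmet\<close>.\<close>
  have "left_inverse n (\<lambda>i s. (if n + 1 - i = s then 1 else 0) * (1 / ?k)
        + (if n = s then 1 else 0) * (if i = n then - of_nat n / ?k else 0))
      (\<lambda>i j. gmet n i j ?u)"
    unfolding left_inverse_def
  proof (intro ballI)
    fix i j assume ij: "i \<in> {1..n}" "j \<in> {1..n}"
    have "(\<Sum>s=1..n. ((if n + 1 - i = s then 1 else 0) * (1 / ?k)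
          + (if n = s then 1 else 0) * (if i = n then - of_nat n / ?k else 0)) * gmet n s j ?u)
        = (\<Sum>s=1..n. (if n + 1 - i = s then 1 else 0) * (1 / ?k * gmet n s j ?u))
        + (\<Sum>s=1..n. (if n = s then 1 else 0) * ((if i = n then - of_nat n / ?k else 0) * gmet n s j ?u))"
      unfolding sum.distrib[symmetric] by (simp only: distrib_right mult.assoc)
    also have "\<dots> = 1 / ?k * gmet n (n + 1 - i) j ?u + (if i = n then - of_nat n / ?k else 0) * gmet n n j ?u"
      by (intro arg_cong2[where f="(+)"] sum_delta_left) (use ij n in auto)
    also have "\<dots> = (if i = j then 1 else 0)"
      using ij n n1 by (subst (1 2) g) auto
    finally show "(\<Sum>s=1..n. ((if n + 1 - i = s then 1 else 0) * (1 / ?k)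
          + (if n = s then 1 else 0) * (if i = n then - of_nat n / ?k else 0)) * gmet n s j ?u)
        = (if i = j then 1 else 0)" .
  qed
  then show ?thesis unfolding nondeg_iff by blast
qed

lemma flat_pencil_gmet:
  assumes n: "n \<ge> 2"
  shows "flat_pencil n (gmet n) (geta n)"
proof -
  have sym: "sym_metric n (gmet n)" "sym_metric n (geta n)"
    unfolding sym_metric_def geta_def using gmet_commute by metis+
  \<comment> \<open>The witness for each \<open>c\<close> is chosen so that translating it by
    \<open>c\<close> lands on the point of \<open>nondeg_gmet_axis\<close>.\<close>
  have "shift (n - 1) c (shift (n - 1) (1 - c) (\<lambda>_. 0)) = shift (n - 1) 1 (\<lambda>_. 0)" for c
    by (auto simp: shift_def)
  then have "nondeg n (pencil (gmet n) (geta n) c) (shift (n - 1) (1 - c) (\<lambda>_. 0))" for c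
    unfolding pencil_eq_shift[OF n] nondeg_shift using nondeg_gmet_axis[OF n] by simp
  moreover have "sym_metric n (pencil (gmet n) (geta n) c)" for c
    using sym unfolding sym_metric_def pencil_def by auto
  ultimately have metric: "metric n (pencil (gmet n) (geta n) c)" for c
    unfolding metric_def by blast
  have "metric n (gmet n)" "metric n (geta n)"
    unfolding metric_def using sym nondeg_gmet_axis[OF n] nondeg_geta_0[OF n] by blast+
  moreover have "flat n (pencil (gmet n) (geta n) c)" for c
    unfolding pencil_eq_shift[OF n] by (rule flat_shift[OF flat_gmet])
  moreover have "cchr n (pencil (gmet n) (geta n) c) i j k u
      = cchr n (gmet n) i j k u + c * cchr n (geta n) i j k u"
    if "nondeg n (gmet n) u" "nondeg n (geta n) u" "nondeg n (pencil (gmet n) (geta n) c) u"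
      "i \<in> {1..n}" "j \<in> {1..n}" "k \<in> {1..n}" for c u i j k
  proof -
    have "nondeg n (gmet n) (shift (n - 1) c u)"
      using that(3) unfolding pencil_eq_shift[OF n] nondeg_shift .
    then show ?thesis
      unfolding pencil_eq_shift[OF n] cchr_shift
      using that by (simp only: cchr_gmet cchr_geta[OF n] gam_shift[OF n])
  qed
  ultimately show ?thesis unfolding flat_pencil_def using metric by blast
qed

section \<open>Polynomiality and comparison with \<open>gp\<close>\<close>

lemma poly_funI:
  fixes I :: "'i set"
  assumes "finite I" "\<And>u. f u = (\<Sum>i\<in>I. c i * (\<Prod>k=1..n. u k ^ \<alpha> i k))"
  shows "poly_fun n f"
proof -
  \<comment> \<open>\<open>poly_fun\<close> indexes terms by their exponents, so members of the
    family with equal exponents are grouped.\<close>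
  have "f u = (\<Sum>\<beta>\<in>\<alpha> ` I. (\<Sum>i\<in>{i\<in>I. \<alpha> i = \<beta>}. c i) * (\<Prod>k=1..n. u k ^ \<beta> k))" for u
  proof -
    have "f u = (\<Sum>\<beta>\<in>\<alpha> ` I. \<Sum>i\<in>{i\<in>I. \<alpha> i = \<beta>}. c i * (\<Prod>k=1..n. u k ^ \<alpha> i k))"
      unfolding assms(2) by (rule sum.image_gen[OF assms(1)])
    also have "\<dots> = (\<Sum>\<beta>\<in>\<alpha> ` I. (\<Sum>i\<in>{i\<in>I. \<alpha> i = \<beta>}. c i) * (\<Prod>k=1..n. u k ^ \<beta> k))"
      unfolding sum_distrib_right by (intro sum.cong refl) auto
    finally show ?thesis .
  qed
  then show ?thesis
    unfolding poly_fun_def using assms(1)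
    by (intro exI[of _ "\<alpha> ` I"] exI[of _ "\<lambda>\<beta>. \<Sum>i\<in>{i\<in>I. \<alpha> i = \<beta>}. c i"]) auto
qed

lemma poly_fun_const: "poly_fun n (\<lambda>_. c)"
  by (rule poly_funI[of "{()}" _ "\<lambda>_. c" "\<lambda>_ _. 0"]) auto

lemma poly_fun_add:
  assumes "poly_fun n f" "poly_fun n g"
  shows "poly_fun n (\<lambda>u. f u + g u)"
proof -
  obtain A c where A: "finite A" "\<And>u. f u = (\<Sum>\<alpha>\<in>A. c \<alpha> * (\<Prod>k=1..n. u k ^ \<alpha> k))"
    using assms(1) unfolding poly_fun_def by blast
  obtain B d where B: "finite B" "\<And>u. g u = (\<Sum>\<alpha>\<in>B. d \<alpha> * (\<Prod>k=1..n. u k ^ \<alpha> k))"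
    using assms(2) unfolding poly_fun_def by blast
  show ?thesis
    by (rule poly_funI[of "A <+> B" _ "case_sum c d" "case_sum id id"])
      (simp_all add: A B sum.Plus)
qed

lemma poly_fun_mult:
  assumes "poly_fun n f" "poly_fun n g"
  shows "poly_fun n (\<lambda>u. f u * g u)"
proof -
  obtain A c where A: "finite A" "\<And>u. f u = (\<Sum>\<alpha>\<in>A. c \<alpha> * (\<Prod>k=1..n. u k ^ \<alpha> k))"
    using assms(1) unfolding poly_fun_def by blast
  obtain B d where B: "finite B" "\<And>u. g u = (\<Sum>\<alpha>\<in>B. d \<alpha> * (\<Prod>k=1..n. u k ^ \<alpha> k))"
    using assms(2) unfolding poly_fun_def by blast
  show ?thesis
  proof (rule poly_funI[of "A \<times> B" _ "\<lambda>(\<alpha>, \<beta>). c \<alpha> * d \<beta>" "\<lambda>(\<alpha>, \<beta>) k. \<alpha> k + \<beta> k"])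
    fix u
    show "f u * g u = (\<Sum>i\<in>A \<times> B. (case i of (\<alpha>, \<beta>) \<Rightarrow> c \<alpha> * d \<beta>)
        * (\<Prod>k=1..n. u k ^ (case i of (\<alpha>, \<beta>) \<Rightarrow> \<lambda>k. \<alpha> k + \<beta> k) k))"
      unfolding A B sum_product sum.cartesian_product
      by (intro sum.cong refl) (auto simp: power_add prod.distrib mult_ac)
  qed (use A B in auto)
qed

lemma poly_fun_sum: "(\<And>i. i \<in> I \<Longrightarrow> poly_fun n (f i)) \<Longrightarrow> poly_fun n (\<lambda>u. \<Sum>i\<in>I. f i u)"
  by (induction I rule: infinite_finite_induct) (auto intro: poly_fun_const poly_fun_add)

lemma poly_fun_coord: "poly_fun n (\<lambda>u. coord n u k)"
proof (cases "k \<in> {1..n}")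
  case True
  have "u k = (\<Prod>m=1..n. u m ^ (if m = k then 1 else 0))" for u :: "nat \<Rightarrow> complex"
    using True by (simp add: if_distrib[of "\<lambda>e. _ ^ e"] cong: if_cong)
  then have "poly_fun n (\<lambda>u. u k)"
    by (intro poly_funI[of "{()}" _ "\<lambda>_. 1" "\<lambda>_ m. if m = k then 1 else 0"]) auto
  then show ?thesis using True by (simp add: coord_def)
next
  case False
  then have "(\<lambda>u. coord n u k) = (\<lambda>_. if k = 0 then 1 else 0)"
    by (auto simp: coord_def)
  then show ?thesis by (simp add: poly_fun_const)
qed

lemma poly_fun_gmet: "poly_fun n (gmet n i j)"
proof (cases "i \<in> {1..n} \<and> j \<in> {1..n}")
  case True
  then have "gmet n i j = (\<lambda>u. 4 * bform n (i - 1) (j - 1) (coord n u) (coord n u))"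
    by (auto simp: gmet_def)
  then show ?thesis
    unfolding bform_def
    by (simp only:) (intro poly_fun_add poly_fun_mult poly_fun_sum poly_fun_const poly_fun_coord)
next
  case False
  then have "gmet n i j = (\<lambda>_. 0)" by (auto simp: gmet_def)
  then show ?thesis by (simp add: poly_fun_const)
qed

lemma usym_eq_esym: "usym n k p = esym n k (\<lambda>i. (p i)\<^sup>2)"
  unfolding usym_def esym_def by (simp add: coeff_linpoly_eq_sum)

lemma pd_usym:
  assumes "k \<in> {1..n}"
  shows "pd (usym n i) k p = 2 * p k * esym1 n k i (\<lambda>m. (p m)\<^sup>2)"
proof -
  let ?x = "\<lambda>m. (p m)\<^sup>2"
  have "(\<lambda>m. ((p(k := t)) m)\<^sup>2) = ?x(k := t\<^sup>2)" for t
    by auto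
  then have "(\<lambda>t. usym n i (p(k := t))) = (\<lambda>t. esym n i (?x(k := t\<^sup>2)))"
    by (simp only: usym_eq_esym)
  moreover have "((\<lambda>t. esym n i (?x(k := t\<^sup>2))) has_field_derivative esym1 n k i ?x * (2 * p k)) (at (p k))"
    by (rule DERIV_chain2[where g="\<lambda>t. t\<^sup>2", OF deriv_esym[OF assms]]) (auto intro!: derivative_eq_intros)
  ultimately show ?thesis
    unfolding pd_def by (simp add: DERIV_imp_deriv mult.commute)
qed

text \<open>The chain rule for squares gives factors \<open>2 * p k\<close> and
  \<open>2 * p l\<close>, which turn \<open>1 / (p k * p l)\<close> into the constant 4 and leave
  the sum of \<open>gmet_frame\<close>.\<close>

lemma gmet_usym:
  assumes p: "\<And>k. k \<in> {1..n} \<Longrightarrow> p k \<noteq> 0" and ij: "i \<in> {1..n}" "j \<in> {1..n}"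
  shows "gmet n i j (\<lambda>k. usym n k p) = gp n i j p"
proof -
  let ?x = "\<lambda>m. (p m)\<^sup>2"
  have x: "coord n (\<lambda>k. usym n k p) = (\<lambda>k. esym n k ?x)"
    by (rule ext) (auto simp: coord_def usym_eq_esym esym_0 esym_gt)
  have "gp n i j p = (\<Sum>k=1..n. \<Sum>l=1..n. (if k = l then 0 else 4 * esym1 n k i ?x) * esym1 n l j ?x)"
    unfolding gp_def using p by (intro sum.cong refl) (auto simp: pd_usym)
  also have "\<dots> = (\<Sum>l=1..n. (\<Sum>k=1..n. if k = l then 0 else 4 * esym1 n k i ?x) * esym1 n l j ?x)"
    unfolding sum_distrib_right by (rule sum.swap)
  also have "\<dots> = (\<Sum>l=1..n. frame n l i ?x * esym1 n l j ?x)"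
  proof (intro sum.cong refl arg_cong2[where f="(*)"])
    fix l assume l: "l \<in> {1..n}"
    have "(\<Sum>k=1..n. if k = l then 0 else 4 * esym1 n k i ?x)
        = (\<Sum>k=1..n. 4 * esym1 n k i ?x - (if k = l then 4 * esym1 n k i ?x else 0))"
      by (intro sum.cong) auto
    then show "(\<Sum>k=1..n. if k = l then 0 else 4 * esym1 n k i ?x) = frame n l i ?x"
      using l by (simp add: sum_subtractf frame_def sum_distrib_left right_diff_distrib)
  qed
  finally show ?thesis using gmet_frame[OF x ij] by simp
qed

theorem mainTheorem2:
  fixes n :: nat
  assumes "n \<ge> 2"
  shows "\<exists>G :: cmetric.
           (\<forall>i j. poly_fun n (G i j)) \<and>
           (\<forall>p. (\<forall>k\<in>{1..n}. p k \<noteq> 0) \<longrightarrow>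
              (\<forall>i\<in>{1..n}. \<forall>j\<in>{1..n}. G i j (\<lambda>k. usym n k p) = gp n i j p)) \<and>
           flat_pencil n G (\<lambda>i j u. pd (G i j) (n - 1) u)"
proof (intro exI[of _ "gmet n"] conjI)
  have "(\<lambda>i j u. pd (gmet n i j) (n - 1) u) = geta n"
    by (intro ext) (simp add: geta_def)
  then show "flat_pencil n (gmet n) (\<lambda>i j u. pd (gmet n i j) (n - 1) u)"
    using flat_pencil_gmet[OF assms] by simp
qed (use poly_fun_gmet gmet_usym in blast)+

end
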